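(* For any complex number $\beta$ and any even positive integer $t$, $$\sum_{\lambda\in \mathcal{SC}}q^{|\lambda|}x^{|\mathcal{H}_t(\lambda)|}b^{\mathrm{BG}(\lambda)}\sum_{h\in\mathcal{H}_t(\lambda)}h^{\beta}=\frac{\left(q^{2t};q^{2t}\right)_{\infty}^{t/2}}{\left(x^2q^{2t};x^2q^{2t}\right)_{\infty}^{t/2}}\left(-bq;q^4\right)_{\infty}\left(-q^3/b;q^4\right)_{\infty}\sum_{k\geq 1}\left(tk\right)^{\beta+1}\frac{x^{2k}q^{2kt}}{1-x^{2k}q^{2kt}}.$$
   Context: A partition is a finite nonincreasing sequence $\lambda=(\lambda_1,\dots,\lambda_\ell)$ of positive integers (the empty partition is allowed), and $|\lambda|$ is the sum of its parts. A partition is identified with its Ferrers diagram, the set of boxes $(i,j)$ (row $i$, column $j$) with $1\le j\le\lambda_i$. The conjugate $\lambda'$ is given by $\lambda'_j=\#\{i:\lambda_i\ge j\}$; $\mathcal{SC}$ is the set of self-conjugate partitions ($\lambda=\lambda'$). The hook-length of a box $(i,j)$ is $\lambda_i-j+\lambda'_j-i+1$; $\mathcal{H}_t(\lambda)$ is the multiset of hook-lengths of $\lambda$ divisible by $t$ (cardinality and sums are taken with multiplicity; empty sums are $0$). The BG-rank is $\mathrm{BG}(\lambda)=\sum_{(i,j)\in\lambda}(-1)^{i+j}$. Also $(a;q)_\infty=\prod_{j\ge0}(1-aq^j)$, and $m^\beta=\exp(\beta\ln m)$ for a positive integer $m$. The identity is one of formal power series in $q$ whose coefficients are polynomials in $x,b,b^{-1}$.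 *)

theory Defs
  imports
    "HOL-Analysis.Analysis"
    "HOL-Computational_Algebra.Computational_Algebra"
begin

definition is_partition :: "nat list \<Rightarrow> bool" where
  "is_partition \<mu> \<longleftrightarrow> sorted_wrt (\<ge>) \<mu> \<and> (\<forall>p\<in>set \<mu>. 0 < p)"

text \<open>Rows and columns are numbered from 1, whereas list positions start at 0.\<close>

definition ferrers :: "nat list \<Rightarrow> (nat \<times> nat) set" where
  "ferrers \<mu> = {(i, j). 1 \<le> i \<and> i \<le> length \<mu> \<and> 1 \<le> j \<and> j \<le> \<mu> ! (i - 1)}"

text \<open>The \<open>j\<close>-th part of the conjugate is the number of parts that are at least \<open>j\<close>; for a
  nonempty partition this is positive exactly for \<open>1 \<le> j \<le> hd \<mu>\<close>.\<close>

definition conjugate :: "nat list \<Rightarrow> nat list" where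
  "conjugate \<mu> =
    (if \<mu> = [] then [] else map (\<lambda>j. length (filter (\<lambda>p. j \<le> p) \<mu>)) [1..<Suc (hd \<mu>)])"

definition self_conjugate_partitions :: "nat list set" where
  "self_conjugate_partitions = {\<mu>. is_partition \<mu> \<and> conjugate \<mu> = \<mu>}"

text \<open>On boxes of the diagram neither of the two subtractions truncates.\<close>

definition hook_length :: "nat list \<Rightarrow> nat \<times> nat \<Rightarrow> nat" where
  "hook_length \<mu> = (\<lambda>(i, j). (\<mu> ! (i - 1) - j) + (conjugate \<mu> ! (j - 1) - i) + 1)"

definition hooks :: "nat \<Rightarrow> nat list \<Rightarrow> nat multiset" where
  "hooks t \<mu> = filter_mset (\<lambda>h. t dvd h) (image_mset (hook_length \<mu>) (mset_set (ferrers \<mu>)))"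

definition BG_rank :: "nat list \<Rightarrow> int" where
  "BG_rank \<mu> = (\<Sum>(i, j)\<in>ferrers \<mu>. (-1) ^ (i + j))"

text \<open>The coefficient ring \<open>\<complex>[x, b, b\<inverse>]\<close> is regarded as a subring of the field \<open>\<complex>(x, b)\<close> of
  rational functions, represented as the fraction field of \<open>\<complex>[x][b]\<close>: the inner polynomial
  variable is \<open>x\<close>, the outer one is \<open>b\<close>.  Power series in \<open>q\<close> over this field carry the
  library's metric, for which convergence means that every coefficient is eventually constant;
  infinite sums and products of series are limits in this sense.\<close>

type_synonym ratfun = "complex poly poly fract"

definition const :: "complex \<Rightarrow> ratfun fps" where
  "const c = fps_const (to_fract [:[:c:]:])"

definition var_x :: "ratfun fps" where
  "var_x = fps_const (to_fract [:[:0, 1:]:])"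

definition var_b :: "ratfun fps" where
  "var_b = fps_const (to_fract [:0, 1:])"

abbreviation var_q :: "ratfun fps" where
  "var_q \<equiv> fps_X"

definition qpochhammer_inf :: "'a::comm_ring_1 fps \<Rightarrow> 'a fps \<Rightarrow> 'a fps" where
  "qpochhammer_inf a q = (\<Prod>j. 1 - a * q ^ j)"

end

theory Submission
  imports Defs
begin

text \<open>A self-conjugate partition is encoded by the finite set \<open>A\<close> of the arm lengths of its diagonal
  boxes, hence by a Maya diagram on the integers in which the reflection \<open>u \<mapsto> -1 - u\<close> swaps beads
  and gaps.  Hooks are the pairs of a gap and a bead above it, and their lengths are the distances.

  For even \<open>t\<close>, moving a bead down by \<open>t k\<close> together with its mirror image removes two ribbons:
  it lowers \<open>|\<lambda>|\<close> by \<open>2 t k\<close>, lowers the number of hooks divisible by \<open>t\<close> by \<open>2 k\<close>, and keeps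
  the BG-rank.  Every Maya diagram has exactly \<open>t k\<close> more addable than removable ribbons of length
  \<open>t k\<close>.  With \<open>y = x^2 q^(2 t)\<close>, \<open>F\<close> the series of all self-conjugate partitions and \<open>F_k\<close> the
  series that also counts the hooks of length \<open>t k\<close>, double counting gives
  \<open>F_k = y^k (F_k + t k F)\<close>, so \<open>F_k = t k y^k / (1 - y^k) F\<close>; weighting by \<open>(t k)^\<beta>\<close> and summing
  over \<open>k\<close> gives the sum over \<open>k\<close> on the right.

  The same relation without weights is a differential equation: \<open>x dF/dx\<close> is the sum of the \<open>F_k\<close>,
  which is also the logarithmic derivative of \<open>(y; y)^(-t/2)\<close>.  So \<open>F (y; y)^(t/2)\<close> does not
  depend on \<open>x\<close>, and at \<open>x = 1\<close> the series \<open>F\<close> is the product of \<open>1 + b^(\<plusminus>1) q^(2 a + 1)\<close>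
  over all \<open>a\<close>, with sign \<open>(-1)^a\<close>.\<close>

unbundle no vec_syntax

section \<open>Coefficientwise limits and the Euler product\<close>

text \<open>Each coefficient receives contributions from finitely many terms only. Every finite
  partial sum containing \<open>J n\<close> therefore already has the final coefficient
  \<open>n\<close>, and the net converges coefficientwise.\<close>

lemma infsum_fps_nth:
  fixes f :: "'i \<Rightarrow> 'a::ab_group_add fps"
  assumes fin: "\<And>n. finite (J n)" and sub: "\<And>n. J n \<subseteq> I"
    and zero: "\<And>n i. i \<in> I \<Longrightarrow> i \<notin> J n \<Longrightarrow> f i $ n = 0"
  shows "infsum f I $ n = (\<Sum>i\<in>J n. f i $ n)"
proof -
  define S where "S = Abs_fps (\<lambda>n. \<Sum>i\<in>J n. f i $ n)"
  have "(sum f \<longlongrightarrow> S) (finite_subsets_at_top I)"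
  proof (rule tendsto_fpsI)
    fix n
    have "sum f X $ n = S $ n" if "finite X" "J n \<subseteq> X" "X \<subseteq> I" for X
    proof -
      have "(\<Sum>i\<in>X. f i $ n) = (\<Sum>i\<in>J n. f i $ n)"
        using that zero by (intro sum.mono_neutral_right) auto
      then show ?thesis by (simp add: S_def fps_sum_nth)
    qed
    then show "\<forall>\<^sub>F X in finite_subsets_at_top I. sum f X $ n = S $ n"
      unfolding eventually_finite_subsets_at_top
      by (intro exI[of _ "J n"]) (simp add: fin sub)
  qed
  then have "(f has_sum S) I" by (simp add: has_sum_def)
  then show ?thesis by (simp add: infsumI S_def)
qed

lemma prodinf_fps_eqI:
  fixes f :: "nat \<Rightarrow> 'a::idom fps"
  assumes lim: "\<And>n. \<forall>\<^sub>F N in sequentially. (\<Prod>j<N. f j) $ n = P $ n" and "P \<noteq> 0"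
  shows "(\<Prod>j. f j) = P"
proof -
  have "(\<lambda>N. \<Prod>j<N. f j) \<longlonglongrightarrow> P"
    by (rule tendsto_fpsI) (rule lim)
  then have "(\<lambda>N. \<Prod>j\<le>N. f j) \<longlonglongrightarrow> P"
    by (simp add: LIMSEQ_lessThan_iff_atMost)
  \<comment> \<open>\<open>raw_has_prod\<close> accepts only a nonzero limit; this is where
    \<open>P \<noteq> 0\<close> enters.\<close>
  then have "raw_has_prod f 0 P"
    using \<open>P \<noteq> 0\<close> by (simp add: raw_has_prod_def)
  then have "f has_prod P" by (simp add: has_prod_def)
  then show ?thesis by (rule has_prod_unique[symmetric])
qed

lemma fps_nth_mult_one_plus:
  fixes P g :: "'a::comm_ring_1 fps"
  assumes "\<And>m. m \<le> n \<Longrightarrow> g $ m = 0"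
  shows "(P * (1 + g)) $ n = P $ n"
proof -
  have "(P * g) $ n = 0"
    by (simp add: fps_mult_nth assms)
  then show ?thesis by (simp add: algebra_simps)
qed

text \<open>The factor of index \<open>j\<close> is 1 modulo \<open>X^(j+1)\<close>, so factors of
  index at least \<open>n\<close> no longer affect coefficient \<open>n\<close>.\<close>

lemma fps_nth_prod_stable:
  fixes g :: "nat \<Rightarrow> 'a::comm_ring_1 fps"
  assumes "\<And>j m. m \<le> j \<Longrightarrow> g j $ m = 0" and "n \<le> N"
  shows "(\<Prod>j<N. 1 + g j) $ n = (\<Prod>j<n. 1 + g j) $ n"
  using \<open>n \<le> N\<close>
proof (induction N rule: dec_induct)
  case base
  then show ?case by simp
next
  case (step N)
  have "(\<Prod>j<Suc N. 1 + g j) $ n = ((\<Prod>j<N. 1 + g j) * (1 + g N)) $ n"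
    by simp
  also have "\<dots> = (\<Prod>j<N. 1 + g j) $ n"
    using step.hyps assms(1) by (intro fps_nth_mult_one_plus) auto
  finally show ?case using step.IH by simp
qed

lemma prodinf_fps_nth:
  fixes g :: "nat \<Rightarrow> 'a::idom fps"
  assumes "\<And>j m. m \<le> j \<Longrightarrow> g j $ m = 0" and "n \<le> N"
  shows "(\<Prod>j. 1 + g j) $ n = (\<Prod>j<N. 1 + g j) $ n"
proof -
  define P where "P = Abs_fps (\<lambda>n. (\<Prod>j<n. 1 + g j) $ n)"
  have P: "(\<Prod>j<N. 1 + g j) $ n = P $ n" if "n \<le> N" for n N
    using fps_nth_prod_stable[of g, OF assms(1) that] by (simp add: P_def)
  have "P $ 0 = 1" by (simp add: P_def)
  then have "P \<noteq> 0" by auto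
  moreover have "\<forall>\<^sub>F N in sequentially. (\<Prod>j<N. 1 + g j) $ n = P $ n" for n
    using eventually_ge_at_top[of n] by eventually_elim (rule P)
  ultimately have "(\<Prod>j. 1 + g j) = P" by (intro prodinf_fps_eqI)
  then show ?thesis using P[OF assms(2)] by simp
qed

lemma fps_power_nth_below:
  fixes y :: "'a::comm_ring_1 fps"
  assumes "y $ 0 = 0" "n < k"
  shows "(y ^ k) $ n = 0"
  using assms startsby_zero_power_prefix by blast

lemma qpochhammer_inf_nth:
  fixes y a :: "'a::idom fps"
  assumes "y $ 0 = 0" "a $ 0 = 0" "n \<le> N"
  shows "qpochhammer_inf a y $ n = (\<Prod>j<N. 1 - a * y ^ j) $ n"
proof -
  have "(- (a * y ^ j)) $ m = 0" if "m \<le> j" for j m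
  proof -
    have "(a * y ^ j) $ m = (\<Sum>i=0..m. a $ i * (y ^ j) $ (m - i))"
      by (simp add: fps_mult_nth)
    also have "\<dots> = 0"
    \<comment> \<open>For \<open>i = 0\<close> the factor from \<open>a\<close> vanishes; for
      \<open>i > 0\<close> the power \<open>y ^ j\<close> is read at \<open>m - i < j\<close>, below
      its order.\<close>
    proof (rule sum.neutral, safe)
      fix i assume "i \<in> {0..m}"
      show "a $ i * (y ^ j) $ (m - i) = 0"
        using assms(1,2) that \<open>i \<in> {0..m}\<close> fps_power_nth_below[of y "m - i" j]
        by (cases "i = 0") auto
    qed
    finally show ?thesis by simp
  qed
  from prodinf_fps_nth[of "\<lambda>j. - (a * y ^ j)", OF this assms(3)]
  show ?thesis by (simp add: qpochhammer_inf_def)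
qed

lemma qpochhammer_inf_nth_0:
  fixes y a :: "'a::idom fps"
  assumes "y $ 0 = 0" "a $ 0 = 0"
  shows "qpochhammer_inf a y $ 0 = 1"
  using qpochhammer_inf_nth[OF assms, of 0 0] by simp

definition euler_product :: "'a::idom fps" where
  "euler_product = qpochhammer_inf fps_X fps_X"

lemma euler_product_nth: "n \<le> N \<Longrightarrow> euler_product $ n = (\<Prod>j<N. 1 - fps_X ^ Suc j) $ n"
  by (simp add: euler_product_def qpochhammer_inf_nth)

text \<open>Each coefficient needs only finitely many factors, and substitution respects finite
  products. Identities for \<open>(q; q)\<close> can thus be proved in one variable and transported
  to \<open>y\<close>.\<close>

lemma euler_product_compose:
  fixes y :: "'a::idom fps"
  assumes "y $ 0 = 0"
  shows "euler_product oo y = qpochhammer_inf y y"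
proof (rule fps_ext)
  fix n
  let ?E = "\<lambda>X. \<Prod>j<n. 1 - X ^ Suc j :: 'a fps"
  have "(euler_product oo y) $ n = (?E fps_X oo y) $ n"
    by (simp add: fps_compose_nth euler_product_nth[of _ n] del: power_Suc)
  also have "?E fps_X oo y = ?E y"
    using assms by (simp add: fps_compose_prod_distrib fps_compose_sub_distrib
        fps_X_power_compose[OF assms] del: power_Suc)
  also have "\<dots> $ n = qpochhammer_inf y y $ n"
    using assms by (simp add: qpochhammer_inf_nth[of y y n n])
  finally show "(euler_product oo y) $ n = qpochhammer_inf y y $ n" .
qed

section \<open>Maya diagrams\<close>

definition maya_diagram :: "int set \<Rightarrow> bool" where
  "maya_diagram S \<longleftrightarrow> (\<exists>M. (\<forall>u\<ge>M. u \<notin> S) \<and> (\<forall>u< -M. u \<in> S))"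

definition inversions :: "nat \<Rightarrow> int set \<Rightarrow> (int \<times> int) set" where
  "inversions t S = {(v, u). v < u \<and> v \<notin> S \<and> u \<in> S \<and> int t dvd u - v}"

lemma maya_diagram_bounds:
  assumes "maya_diagram S"
  obtains M where "\<And>u. u \<in> S \<Longrightarrow> u < M" "\<And>u. u \<notin> S \<Longrightarrow> - M \<le> u"
  using assms unfolding maya_diagram_def by (meson not_le)

lemma maya_diagram_finite:
  assumes "maya_diagram S"
  shows "finite {i. i < v \<and> i \<notin> S \<and> P i}" "finite {j. v \<le> j \<and> j \<in> S \<and> P j}"
proof -
  obtain M where M: "\<And>u. u \<in> S \<Longrightarrow> u < M" "\<And>u. u \<notin> S \<Longrightarrow> - M \<le> u"
    using maya_diagram_bounds[OF assms] by blast
  have "{i. i < v \<and> i \<notin> S \<and> P i} \<subseteq> {-M..<v}" using M(2) by auto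
  then show "finite {i. i < v \<and> i \<notin> S \<and> P i}" by (rule finite_subset) simp
  have "{j. v \<le> j \<and> j \<in> S \<and> P j} \<subseteq> {v..<M}" using M(1) by auto
  then show "finite {j. v \<le> j \<and> j \<in> S \<and> P j}" by (rule finite_subset) simp
qed

lemma finite_inversions:
  assumes "maya_diagram S"
  shows "finite (inversions t S)"
proof -
  obtain M where M: "\<And>u. u \<in> S \<Longrightarrow> u < M" "\<And>u. u \<notin> S \<Longrightarrow> - M \<le> u"
    using maya_diagram_bounds[OF assms] by blast
  have "v \<in> {-M..<M}" "u \<in> {-M..<M}" if "(v, u) \<in> inversions t S" for v u
    using that M(1)[of u] M(2)[of v] by (force simp: inversions_def)+
  then have "inversions t S \<subseteq> {-M..<M} \<times> {-M..<M}" by auto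
  then show ?thesis by (rule finite_subset) simp
qed

lemma maya_diagram_insert: "maya_diagram S \<Longrightarrow> maya_diagram (insert v S)"
proof -
  assume "maya_diagram S"
  then obtain M where M: "\<And>u. u \<ge> M \<Longrightarrow> u \<notin> S" "\<And>u. u < -M \<Longrightarrow> u \<in> S"
    unfolding maya_diagram_def by blast
  then show ?thesis
    unfolding maya_diagram_def by (intro exI[of _ "max M (v + 1)"]) auto
qed

lemma maya_diagram_remove: "maya_diagram S \<Longrightarrow> maya_diagram (S - {v})"
proof -
  assume "maya_diagram S"
  then obtain M where M: "\<And>u. u \<ge> M \<Longrightarrow> u \<notin> S" "\<And>u. u < -M \<Longrightarrow> u \<in> S"
    unfolding maya_diagram_def by blast
  then show ?thesis
    unfolding maya_diagram_def by (intro exI[of _ "max M (- v)"]) auto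
qed

text \<open>The number of inversions created by a bead inserted at the empty position \<open>v\<close>.\<close>

definition bead_balance :: "nat \<Rightarrow> int set \<Rightarrow> int \<Rightarrow> int" where
  "bead_balance t S v =
     int (card {i. i < v \<and> i \<notin> S \<and> int t dvd v - i})
   - int (card {j. v \<le> j \<and> j \<in> S \<and> int t dvd j - v})"

text \<open>Only the position \<open>v\<close> changes its role: a gap at \<open>v\<close> joins the
  gaps below, a bead at \<open>v\<close> leaves the beads above. The weak inequality
  \<open>v \<le> j\<close> in \<open>bead_balance\<close> makes both cases count +1.\<close>

lemma bead_balance_shift:
  assumes "maya_diagram S" "0 < t"
  shows "bead_balance t S (v + int t) = bead_balance t S v + 1"
proof -
  have le: "i \<le> v" if "i < v + int t" "int t dvd v + int t - i" for i
    using that zdvd_not_zless[of "v + int t - i" "int t"] by force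
  have ge: "v + int t \<le> j" if "v < j" "int t dvd j - v" for j
    using that zdvd_imp_le[of "int t" "j - v"] by simp
  have dvd_iff: "int t dvd v + int t - i \<longleftrightarrow> int t dvd v - i" for i
    by (metis add_diff_eq add.commute diff_add_eq dvd_add_triv_left_iff)
  have dvd_iff': "int t dvd j - (v + int t) \<longleftrightarrow> int t dvd j - v" for j
    by (metis diff_diff_eq dvd_add_triv_right_iff diff_add_cancel)
  define lo where "lo = {i. i < v \<and> i \<notin> S \<and> int t dvd v - i}"
  define hi where "hi = {j. v + int t \<le> j \<and> j \<in> S \<and> int t dvd j - v}"
  have fin: "finite lo" "finite hi"
    unfolding lo_def hi_def by (intro maya_diagram_finite assms)+
  have lo': "{i. i < v + int t \<and> i \<notin> S \<and> int t dvd v + int t - i} = (if v \<in> S then lo else insert v lo)"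
    unfolding lo_def using le assms(2) by (auto simp: dvd_iff intro: le_neq_trans)
  have hi': "{j. v \<le> j \<and> j \<in> S \<and> int t dvd j - v} = (if v \<in> S then insert v hi else hi)"
    unfolding hi_def using ge assms(2) by (auto simp: order_le_less)
  have "v \<notin> lo" "v \<notin> hi" using assms(2) by (auto simp: lo_def hi_def)
  then have "int (card (if v \<in> S then lo else insert v lo)) - int (card hi)
      = int (card lo) - int (card (if v \<in> S then insert v hi else hi)) + 1"
    using fin by simp
  then show ?thesis
    unfolding bead_balance_def lo' hi' dvd_iff' using lo_def hi_def by simp
qed

lemma bead_balance_shift_multiple:
  assumes "maya_diagram S" "0 < t"
  shows "bead_balance t S (v + int (t * k)) = bead_balance t S v + int k"
proof (induction k)
  case (Suc k)
  have "bead_balance t S (v + int (t * Suc k)) = bead_balance t S (v + int (t * k) + int t)"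
    by (rule arg_cong[of _ _ "bead_balance t S"]) simp
  then show ?case
    using bead_balance_shift[OF assms, of "v + int (t * k)"] Suc by simp
qed simp

lemma card_inversions_insert:
  assumes "maya_diagram S" "v \<notin> S"
  shows "int (card (inversions t (insert v S))) = int (card (inversions t S)) + bead_balance t S v"
proof -
  define lo where "lo = {i. i < v \<and> i \<notin> S \<and> int t dvd v - i}"
  define hi where "hi = {j. v \<le> j \<and> j \<in> S \<and> int t dvd j - v}"
  \<comment> \<open>\<open>K\<close> consists of the inversions that survive the insertion: those
    that do not use \<open>v\<close> as their gap.\<close>
  define K where "K = inversions t S - Pair v ` hi"
  have fin: "finite lo" "finite hi" "finite (inversions t S)"
    unfolding lo_def hi_def by (intro maya_diagram_finite finite_inversions assms)+
  have "Pair v ` hi \<subseteq> inversions t S"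
    using assms(2) by (auto simp: hi_def inversions_def order_le_less)
  then have "card (inversions t S) = card K + card (Pair v ` hi)"
    unfolding K_def using fin
    by (metis card_Diff_subset card_mono finite_imageI le_add_diff_inverse2)
  moreover have "card (Pair v ` hi) = card hi"
    by (intro card_image) (auto simp: inj_on_def)
  moreover have "inversions t (insert v S) = K \<union> (\<lambda>i. (i, v)) ` lo"
    using assms(2) by (auto simp: K_def lo_def hi_def inversions_def)
  moreover have "K \<inter> (\<lambda>i. (i, v)) ` lo = {}"
    using assms(2) by (auto simp: K_def inversions_def)
  moreover have "card ((\<lambda>i. (i, v)) ` lo) = card lo"
    by (intro card_image) (auto simp: inj_on_def)
  ultimately show ?thesis
    using fin by (simp add: card_Un_disjoint K_def bead_balance_def lo_def hi_def)
qed

text \<open>Both diagrams arise from \<open>?T\<close> by inserting a single bead, at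
  \<open>v + t k\<close> or at \<open>v\<close>, and the two balances differ by
  \<open>k\<close>.\<close>

lemma card_inversions_move:
  assumes "maya_diagram S" "0 < t" "v \<notin> S" "v + int (t * k) \<in> S"
  shows "card (inversions t S) = card (inversions t (insert v (S - {v + int (t * k)}))) + k"
proof -
  let ?u = "v + int (t * k)" and ?T = "S - {v + int (t * k)}"
  have T: "maya_diagram ?T" using assms(1) by (rule maya_diagram_remove)
  have "int (card (inversions t (insert ?u ?T))) = int (card (inversions t ?T)) + bead_balance t ?T ?u"
    by (rule card_inversions_insert) (use T in auto)
  moreover have "insert ?u ?T = S" using assms(4) by auto
  moreover have "int (card (inversions t (insert v ?T))) = int (card (inversions t ?T)) + bead_balance t ?T v"
    by (rule card_inversions_insert) (use T assms in auto)
  ultimately show ?thesis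
    using bead_balance_shift_multiple[OF T assms(2), of v k] by simp
qed

text \<open>Compare the diagram with its translate down by \<open>d\<close> inside a window: the
  translate has \<open>d\<close> beads fewer there, and discarding the common beads keeps this
  surplus.\<close>

lemma card_addable_removable:
  assumes "maya_diagram S"
  shows "card {v. v \<in> S \<and> v + int d \<notin> S} = card {v. v \<notin> S \<and> v + int d \<in> S} + d"
    "finite {v. v \<in> S \<and> v + int d \<notin> S}" "finite {v. v \<notin> S \<and> v + int d \<in> S}"
proof -
  obtain M where M: "\<And>u. u \<in> S \<Longrightarrow> u < M" "\<And>u. u \<notin> S \<Longrightarrow> - M \<le> u"
    using maya_diagram_bounds[OF assms] by blast
  \<comment> \<open>The window starts \<open>d\<close> below the bound for gaps, so its first
    \<open>d\<close> positions are beads and every ribbon of either kind starts inside it.\<close>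
  define L where "L = - M - int d"
  have L: "u \<notin> S \<Longrightarrow> L + int d \<le> u" for u
    using M(2)[of u] by (simp add: L_def)
  have "L \<le> M" using M(2)[of M] M(1)[of M] by (force simp: L_def)
  define P where "P = {v\<in>{L..<M}. v \<in> S}"
  define Q where "Q = {v\<in>{L..<M}. v + int d \<in> S}"
  have fin: "finite P" "finite Q"
    by (rule finite_subset[of _ "{L..<M}"]; force simp: P_def Q_def)+
  have "{v. v \<in> S \<and> v + int d \<notin> S} = P - Q" 
    unfolding P_def Q_def by (auto dest: L M(1))
  moreover have "{v. v \<notin> S \<and> v + int d \<in> S} = Q - P"
    unfolding P_def Q_def by (auto dest: L M(1))
  moreover have "card P = card Q + d"
  proof -
    have "P = {L..<L + int d} \<union> (\<lambda>v. v + int d) ` Q"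
    proof (intro set_eqI iffI)
      fix v assume v: "v \<in> P"
      show "v \<in> {L..<L + int d} \<union> (\<lambda>v. v + int d) ` Q"
      proof (cases "v < L + int d")
        case False
        then have "v - int d \<in> Q" using v by (auto simp: P_def Q_def)
        then show ?thesis by (auto intro: rev_image_eqI)
      qed (use v P_def in auto)
    next
      fix v assume "v \<in> {L..<L + int d} \<union> (\<lambda>v. v + int d) ` Q"
      then show "v \<in> P"
        using L[of v] M(1)[of v] \<open>L \<le> M\<close>
        by (cases "v \<in> S") (auto simp: P_def Q_def)
    qed
    moreover have "{L..<L + int d} \<inter> (\<lambda>v. v + int d) ` Q = {}" by (auto simp: Q_def)
    moreover have "card ((\<lambda>v. v + int d) ` Q) = card Q" by (intro card_image) (auto simp: inj_on_def)
    ultimately show ?thesis using fin by (simp add: card_Un_disjoint)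
  qed
  moreover have "card P = card (P - Q) + card (P \<inter> Q)" "card Q = card (Q - P) + card (P \<inter> Q)"
    using fin by (metis card_Diff_subset_Int card_mono finite_Int inf_commute inf_le1 le_add_diff_inverse2)+
  ultimately show "card {v. v \<in> S \<and> v + int d \<notin> S} = card {v. v \<notin> S \<and> v + int d \<in> S} + d"
    "finite {v. v \<in> S \<and> v + int d \<notin> S}" "finite {v. v \<notin> S \<and> v + int d \<in> S}"
    using fin by simp_all
qed

section \<open>Self-conjugate Maya diagrams\<close>

text \<open>Reflection \<open>u \<mapsto> -1 - u\<close> swaps beads and gaps, so the diagram is determined by the set of
  its nonnegative beads.\<close>

definition bead_index :: "int \<Rightarrow> nat" where
  "bead_index u = (if 0 \<le> u then nat u else nat (- 1 - u))"

definition sym_maya :: "nat set \<Rightarrow> int set" where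
  "sym_maya A = {u. 0 \<le> u \<longleftrightarrow> bead_index u \<in> A}"

text \<open>The size of the partition: a symmetric principal hook with arm \<open>a\<close> has
  \<open>2 a + 1\<close> boxes.\<close>

definition hook_weight :: "nat set \<Rightarrow> nat" where
  "hook_weight A = (\<Sum>a\<in>A. 2 * a + 1)"

text \<open>The BG-rank: the alternating signs along a principal hook with arm \<open>a\<close> add
  up to \<open>(-1)^a\<close>.\<close>

definition sign_sum :: "nat set \<Rightarrow> int" where
  "sign_sum A = (\<Sum>a\<in>A. (-1) ^ a)"

definition removable :: "nat \<Rightarrow> nat set \<Rightarrow> int set" where
  "removable d A = {v. v \<notin> sym_maya A \<and> v + int d \<in> sym_maya A}"

definition addable :: "nat \<Rightarrow> nat set \<Rightarrow> int set" where
  "addable d A = {v. v \<in> sym_maya A \<and> v + int d \<notin> sym_maya A}"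

definition hook_count :: "nat \<Rightarrow> nat set \<Rightarrow> nat" where
  "hook_count t A = card (inversions t (sym_maya A))"

text \<open>Toggling two indices moves a bead between \<open>v\<close> and \<open>v + d\<close>
  together with its mirror image. As a symmetric difference the operation is its own inverse, so it
  serves for removal and for addition.\<close>

definition slide :: "nat \<Rightarrow> int \<Rightarrow> nat set \<Rightarrow> nat set" where
  "slide d v A = sym_diff A {bead_index v, bead_index (v + int d)}"

lemma bead_index_mirror [simp]: "bead_index (- 1 - u) = bead_index u"
  by (simp add: bead_index_def)

lemma bead_index_eq_iff: "bead_index u = bead_index v \<longleftrightarrow> u = v \<or> u = - 1 - v"
  by (auto simp: bead_index_def)

lemma sym_maya_mirror: "- 1 - u \<in> sym_maya A \<longleftrightarrow> u \<notin> sym_maya A"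
  by (auto simp: sym_maya_def)

lemma maya_diagram_sym_maya:
  assumes "finite A"
  shows "maya_diagram (sym_maya A)"
proof -
  obtain N where "\<forall>a\<in>A. a < N" using assms finite_nat_set_iff_bounded by blast
  then show ?thesis
    unfolding maya_diagram_def sym_maya_def bead_index_def
    by (intro exI[of _ "int N"]) force
qed

lemma sym_maya_sym_diff:
  "u \<in> sym_maya (sym_diff A B) \<longleftrightarrow> (u \<in> sym_maya A) \<noteq> (bead_index u \<in> B)"
  by (auto simp: sym_maya_def)

text \<open>A position and its mirror image have opposite parity, so an even shift never joins them.
  This keeps a ribbon apart from its mirror image and is the reason for requiring \<open>t\<close>
  even.\<close>

lemma even_shift_distinct:
  assumes "even d" "0 < d"
  shows "bead_index v \<noteq> bead_index (v + int d)"
proof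
  assume "bead_index v = bead_index (v + int d)"
  then have "2 * v + 1 = - int d" using assms(2) by (auto simp: bead_index_eq_iff)
  then have "even (2 * v + 1)" using assms(1) by simp
  then show False by simp
qed

lemma slide_slide: "slide d v (slide d v A) = A"
  by (auto simp: slide_def)

lemma finite_slide [simp]: "finite (slide d v A) = finite A"
  by (simp add: slide_def)

lemma slide_removable_iff:
  assumes "even d" "0 < d"
  shows "v \<in> removable d (slide d v A) \<longleftrightarrow> v \<in> addable d A"
  using even_shift_distinct[OF assms, of v]
  by (auto simp: removable_def addable_def slide_def sym_maya_sym_diff)

text \<open>The four toggled positions are read as two successive bead moves, \<open>v + d\<close>
  to \<open>v\<close> and then \<open>-1 - v\<close> to \<open>-1 - v - d\<close>; parity keeps the
  moves from interfering.\<close>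

lemma sym_maya_slide:
  assumes "even d" "0 < d" "v \<in> removable d A"
  shows "sym_maya (slide d v A) =
    insert (- 1 - v - int d) (insert v (sym_maya A - {v + int d}) - {- 1 - v})" (is "_ = ?R")
proof (rule set_eqI)
  fix u
  have v: "v \<notin> sym_maya A" "v + int d \<in> sym_maya A"
    using assms(3) by (auto simp: removable_def)
  have v': "- 1 - v \<in> sym_maya A" "- 1 - v - int d \<notin> sym_maya A"
    using v sym_maya_mirror[of v A] sym_maya_mirror[of "v + int d" A] by (simp_all add: algebra_simps)
  have ne: "v \<noteq> - 1 - v" "v + int d \<noteq> - 1 - v" "v \<noteq> - 1 - v - int d" "v + int d \<noteq> - 1 - v - int d"
    using assms(1) by presburger+
  have "u \<in> sym_maya (slide d v A) \<longleftrightarrow>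
      (u \<in> sym_maya A) \<noteq> (u \<in> {v, - 1 - v, v + int d, - 1 - v - int d})"
    by (simp add: slide_def sym_maya_sym_diff bead_index_eq_iff algebra_simps)
  also have "\<dots> \<longleftrightarrow> u \<in> ?R"
    using v v' ne assms(2) by auto
  finally show "u \<in> sym_maya (slide d v A) \<longleftrightarrow> u \<in> ?R" .
qed

text \<open>Each of the two mirrored moves costs \<open>k\<close> inversions; the second is still
  possible after the first, which touches neither of its ends.\<close>

lemma hook_count_slide:
  assumes "finite A" "even t" "0 < t" "0 < k" "v \<in> removable (t * k) A"
  shows "hook_count t A = hook_count t (slide (t * k) v A) + 2 * k"
proof -
  let ?d = "t * k" and ?S = "sym_maya A"
  let ?T = "insert v (?S - {v + int ?d})"
  have d: "even ?d" "0 < ?d" using assms by auto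
  have S: "maya_diagram ?S" using assms(1) by (rule maya_diagram_sym_maya)
  then have T: "maya_diagram ?T" by (intro maya_diagram_insert maya_diagram_remove)
  have v: "v \<notin> ?S" "v + int ?d \<in> ?S"
    using assms(5) by (auto simp: removable_def)
  have v': "- 1 - v \<in> ?S" "- 1 - v - int ?d \<notin> ?S"
    using v sym_maya_mirror[of v A] sym_maya_mirror[of "v + int ?d" A] by (simp_all add: algebra_simps)
  have ne: "v + int ?d \<noteq> - 1 - v" "v \<noteq> - 1 - v - int ?d"
    using d(1) by presburger+
  have "card (inversions t ?S) = card (inversions t ?T) + k"
    using S assms(3) v by (rule card_inversions_move)
  also have "card (inversions t ?T) =
      card (inversions t (insert (- 1 - v - int ?d) (?T - {- 1 - v - int ?d + int ?d}))) + k"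
    by (rule card_inversions_move[OF T assms(3)]) (use v' ne in auto)
  also have "insert (- 1 - v - int ?d) (?T - {- 1 - v - int ?d + int ?d}) = sym_maya (slide ?d v A)"
    using sym_maya_slide[OF d assms(5)] by simp
  finally show ?thesis by (simp add: hook_count_def)
qed

lemma sum_toggle:
  fixes g :: "nat \<Rightarrow> int"
  assumes "finite A" "x \<noteq> y"
  shows "sum g (sym_diff A {x, y}) =
    sum g A + (if x \<in> A then - g x else g x) + (if y \<in> A then - g y else g y)"
proof -
  have *: "sum g (sym_diff B {z}) = sum g B + (if z \<in> B then - g z else g z)" if "finite B" for B z
  proof (cases "z \<in> B")
    case True
    then have "sym_diff B {z} = B - {z}" by auto
    then show ?thesis using True that by (simp add: sum_diff1)
  next
    case False
    then have "sym_diff B {z} = insert z B" by auto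
    then show ?thesis using False that by simp
  qed
  have "sym_diff A {x, y} = sym_diff (sym_diff A {x}) {y}" using assms(2) by auto
  moreover have "y \<in> sym_diff A {x} \<longleftrightarrow> y \<in> A" using assms(2) by auto
  ultimately show ?thesis using *[of "sym_diff A {x}" y] *[of A x] assms(1) by simp
qed

text \<open>Inserting a bead at \<open>u\<close> changes the weight by \<open>2 u + 1\<close>, whatever the sign of \<open>u\<close>: for
  \<open>u < 0\<close> it deletes \<open>-1 - u\<close> from \<open>A\<close>.\<close>

lemma hook_weight_slide:
  assumes "finite A" "even d" "0 < d" "v \<in> removable d A"
  shows "hook_weight A = hook_weight (slide d v A) + 2 * d"
proof -
  define g where "g = (\<lambda>a. 2 * int a + 1)"
  have w: "int (hook_weight B) = sum g B" for B
    by (simp add: hook_weight_def g_def of_nat_sum add.commute)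
  have v: "v \<notin> sym_maya A" "v + int d \<in> sym_maya A"
    using assms(4) by (auto simp: removable_def)
  have "(if bead_index v \<in> A then - g (bead_index v) else g (bead_index v)) = 2 * v + 1"
    using v(1) by (auto simp: sym_maya_def g_def bead_index_def)
  moreover have "(if bead_index (v + int d) \<in> A then - g (bead_index (v + int d))
      else g (bead_index (v + int d))) = - (2 * (v + int d) + 1)"
    using v(2) by (auto simp: sym_maya_def g_def bead_index_def)
  ultimately have "sum g (slide d v A) = sum g A - 2 * int d"
    unfolding slide_def using sum_toggle[OF assms(1) even_shift_distinct[OF assms(2,3)], of g v] by simp
  then show ?thesis using w[of A] w[of "slide d v A"] by simp
qed

text \<open>Creating a bead at \<open>u\<close> contributes \<open>(-1)^u\<close> for either sign of
  \<open>u\<close>: for \<open>u < 0\<close> the index \<open>-1 - u\<close> has the opposite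
  parity, but it is deleted instead of inserted. A move by an even distance therefore
  cancels.\<close>

lemma sign_sum_slide:
  assumes "finite A" "even d" "0 < d" "v \<in> removable d A"
  shows "sign_sum (slide d v A) = sign_sum A"
proof -
  define g :: "nat \<Rightarrow> int" where "g = (\<lambda>a. (-1) ^ a)"
  have v: "v \<notin> sym_maya A" "v + int d \<in> sym_maya A"
    using assms(4) by (auto simp: removable_def)
  have par: "(-1 :: int) ^ nat u = (if even u then 1 else -1)" if "0 \<le> u" for u
    using that by (simp add: even_nat_iff minus_one_power_iff)
  have *: "(if bead_index u \<in> A then - g (bead_index u) else g (bead_index u)) =
      (if u \<in> sym_maya A then -1 else 1) * (if even u then 1 else -1)" for u
    by (auto simp: sym_maya_def g_def bead_index_def par)
  have "sum g (slide d v A) = sum g A"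
    unfolding slide_def
    using sum_toggle[OF assms(1) even_shift_distinct[OF assms(2,3)], of g v] v assms(2)
    unfolding * by simp
  then show ?thesis by (simp add: sign_sum_def g_def)
qed

lemma card_addable:
  assumes "finite A"
  shows "card (addable d A) = card (removable d A) + d" "finite (addable d A)" "finite (removable d A)"
  using card_addable_removable[OF maya_diagram_sym_maya[OF assms], of d]
  by (simp_all add: addable_def removable_def)

section \<open>Sets of fixed weight and the counting of their ribbons\<close>

definition of_weight :: "nat \<Rightarrow> nat set set" where
  "of_weight n = {A. finite A \<and> hook_weight A = n}"

lemma of_weight_subset: "of_weight n \<subseteq> Pow {..n}"
proof safe
  fix A a assume A: "A \<in> of_weight n" "a \<in> A"
  then have "2 * a + 1 \<le> hook_weight A"
    unfolding hook_weight_def of_weight_def by (intro member_le_sum) auto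
  then show "a \<le> n" using A by (simp add: of_weight_def)
qed

lemma finite_of_weight [simp]: "finite (of_weight n)"
  by (rule finite_subset[OF of_weight_subset]) simp

lemma removable_empty:
  assumes "A \<in> of_weight n" "even d" "0 < d" "n < 2 * d"
  shows "removable d A = {}"
  using hook_weight_slide[of A d] assms by (force simp: of_weight_def)

text \<open>Double counting of pairs consisting of a set and a mirror pair of ribbons of length \<open>t k\<close>,
  removed on the left and added on the right.\<close>

lemma sum_removable_eq_sum_addable:
  fixes \<phi> :: "nat \<Rightarrow> int \<Rightarrow> 'a::comm_semiring_1"
  assumes t: "even t" "0 < t" and k: "0 < k"
  shows "(\<Sum>A\<in>of_weight (n + 2 * (t * k)). \<phi> (hook_count t A) (sign_sum A) * of_nat (card (removable (t * k) A)))
       = (\<Sum>A\<in>of_weight n. \<phi> (hook_count t A + 2 * k) (sign_sum A) * of_nat (card (addable (t * k) A)))"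
proof -
  let ?d = "t * k"
  have d: "even ?d" "0 < ?d" using t k by auto
  have fin: "\<forall>A\<in>of_weight m. finite (removable ?d A) \<and> finite (addable ?d A)" for m
    using card_addable(2,3) by (auto simp: of_weight_def)
  have "(\<Sum>A\<in>of_weight (n + 2 * ?d). \<phi> (hook_count t A) (sign_sum A) * of_nat (card (removable ?d A)))
      = (\<Sum>(A, v)\<in>(SIGMA A:of_weight (n + 2 * ?d). removable ?d A). \<phi> (hook_count t A) (sign_sum A))"
    using fin by (subst sum.Sigma[symmetric]) (auto simp: mult.commute)
  also have "\<dots> = (\<Sum>(A, v)\<in>(SIGMA A:of_weight n. addable ?d A). \<phi> (hook_count t A + 2 * k) (sign_sum A))"
  \<comment> \<open>The same map serves in both directions because \<open>slide\<close> is an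
    involution; \<open>v\<close> is kept as the marker of the ribbon.\<close>
  proof (rule sum.reindex_bij_witness[of _ "\<lambda>(A, v). (slide ?d v A, v)" "\<lambda>(A, v). (slide ?d v A, v)"])
    fix p assume "p \<in> (SIGMA A:of_weight (n + 2 * ?d). removable ?d A)"
    then obtain A v where p: "p = (A, v)" and A: "finite A" "hook_weight A = n + 2 * ?d"
      and v: "v \<in> removable ?d A"
      by (auto simp: of_weight_def)
    have "v \<in> addable ?d (slide ?d v A)"
      using v slide_removable_iff[OF d, of v "slide ?d v A"] by (simp add: slide_slide)
    then show "(case p of (A, v) \<Rightarrow> (slide ?d v A, v)) \<in> (SIGMA A:of_weight n. addable ?d A)"
      using hook_weight_slide[OF A(1) d v] A p by (simp add: of_weight_def)
    show "(case case p of (A, v) \<Rightarrow> (slide ?d v A, v) of (A, v) \<Rightarrow> \<phi> (hook_count t A + 2 * k) (sign_sum A))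
        = (case p of (A, v) \<Rightarrow> \<phi> (hook_count t A) (sign_sum A))"
      using hook_count_slide[OF A(1) t k v] sign_sum_slide[OF A(1) d v] p by simp
  next
    fix p assume "p \<in> (SIGMA A:of_weight n. addable ?d A)"
    then obtain A v where p: "p = (A, v)" and A: "finite A" "hook_weight A = n"
      and v: "v \<in> addable ?d A"
      by (auto simp: of_weight_def)
    have r: "v \<in> removable ?d (slide ?d v A)"
      using v slide_removable_iff[OF d] by simp
    have "hook_weight (slide ?d v A) = n + 2 * ?d"
      using hook_weight_slide[OF _ d r] A by (simp add: slide_slide)
    then show "(case p of (A, v) \<Rightarrow> (slide ?d v A, v)) \<in> (SIGMA A:of_weight (n + 2 * ?d). removable ?d A)"
      using p r A by (simp add: of_weight_def)
  qed (auto simp: slide_slide)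
  also have "\<dots> = (\<Sum>A\<in>of_weight n. \<phi> (hook_count t A + 2 * k) (sign_sum A) * of_nat (card (addable ?d A)))"
    using fin by (subst sum.Sigma[symmetric]) (auto simp: mult.commute)
  finally show ?thesis .
qed

text \<open>Inversions are sorted by their distance \<open>t k\<close>. A removable ribbon of that
  length needs \<open>2 t k \<le> n\<close>, so cutting off at \<open>k \<le> n\<close> loses
  nothing.\<close>

lemma inversions_eq_Union:
  assumes A: "A \<in> of_weight n" and t: "even t" "0 < t"
  shows "inversions t (sym_maya A) =
    (\<Union>k\<in>{1..n}. (\<lambda>v. (v, v + int (t * k))) ` removable (t * k) A)"
proof (intro equalityI subsetI)
  fix p assume "p \<in> inversions t (sym_maya A)"
  then obtain v u where p: "p = (v, u)" "v < u" "v \<notin> sym_maya A" "u \<in> sym_maya A" "int t dvd u - v"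
    by (auto simp: inversions_def)
  obtain m where m: "u - v = int t * m" using p(5) by blast
  then have "0 < m" using p(2) t by (metis diff_gt_0_iff_gt of_nat_0_less_iff zero_less_mult_pos)
  define k where "k = nat m"
  have k: "1 \<le> k" "u = v + int (t * k)" using m \<open>0 < m\<close> by (auto simp: k_def)
  then have r: "v \<in> removable (t * k) A" using p by (simp add: removable_def)
  have "2 * (t * k) \<le> n"
    using removable_empty[OF A, of "t * k"] r t k by force
  moreover have "k \<le> t * k" using t by simp
  ultimately have "k \<le> n" by linarith
  then show "p \<in> (\<Union>k\<in>{1..n}. (\<lambda>v. (v, v + int (t * k))) ` removable (t * k) A)"
    using p(1) k r by auto
next
  fix p assume "p \<in> (\<Union>k\<in>{1..n}. (\<lambda>v. (v, v + int (t * k))) ` removable (t * k) A)"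
  then show "p \<in> inversions t (sym_maya A)"
    using t by (auto simp: inversions_def removable_def)
qed

lemma sum_inversions:
  fixes g :: "nat \<Rightarrow> 'a::comm_semiring_1"
  assumes A: "A \<in> of_weight n" and t: "even t" "0 < t"
  shows "(\<Sum>(v, u)\<in>inversions t (sym_maya A). g (nat (u - v))) =
    (\<Sum>k=1..n. of_nat (card (removable (t * k) A)) * g (t * k))"
proof -
  have fin: "finite (removable d A)" for d
    using A card_addable(3) by (simp add: of_weight_def)
  have "(\<Sum>(v, u)\<in>inversions t (sym_maya A). g (nat (u - v))) =
      (\<Sum>k=1..n. \<Sum>(v, u)\<in>(\<lambda>v. (v, v + int (t * k))) ` removable (t * k) A. g (nat (u - v)))"
    unfolding inversions_eq_Union[OF assms]
    using t fin by (intro sum.UNION_disjoint) auto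
  also have "\<dots> = (\<Sum>k=1..n. of_nat (card (removable (t * k) A)) * g (t * k))"
    by (intro sum.cong refl, subst sum.reindex) (auto simp: inj_on_def simp flip: of_nat_mult)
  finally show ?thesis .
qed

section \<open>Hooks of symmetric diagrams\<close>

lemma initial_segment_iff:
  fixes P :: "nat \<Rightarrow> bool"
  assumes fin: "finite {k. 1 \<le> k \<and> P k}"
    and down: "\<And>x y. P x \<Longrightarrow> 1 \<le> y \<Longrightarrow> y \<le> x \<Longrightarrow> P y" and "1 \<le> i"
  shows "i \<le> card {k. 1 \<le> k \<and> P k} \<longleftrightarrow> P i"
proof
  assume "P i"
  then have "{1..i} \<subseteq> {k. 1 \<le> k \<and> P k}" using down by auto
  then show "i \<le> card {k. 1 \<le> k \<and> P k}" using card_mono[OF fin, of "{1..i}"] by simp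
next
  assume le: "i \<le> card {k. 1 \<le> k \<and> P k}"
  show "P i"
  proof (rule ccontr)
    assume "\<not> P i"
    have "{k. 1 \<le> k \<and> P k} \<subseteq> {1..<i}"
    proof
      fix x assume x: "x \<in> {k. 1 \<le> k \<and> P k}"
      then have "\<not> i \<le> x" using down[of x i] \<open>1 \<le> i\<close> \<open>\<not> P i\<close> by blast
      then show "x \<in> {1..<i}" using x by simp
    qed
    then have "card {k. 1 \<le> k \<and> P k} \<le> card {1..<i}" by (intro card_mono) auto
    then show False using le \<open>1 \<le> i\<close> by simp
  qed
qed

text \<open>Row lengths form a total function, zero below the diagram. Symmetry under transposition
  alone already forces \<open>r\<close> to be nonincreasing and to vanish beyond row
  \<open>r 1\<close>.\<close>

locale symmetric_rows =
  fixes r :: "nat \<Rightarrow> nat"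
  assumes sym: "1 \<le> i \<Longrightarrow> 1 \<le> j \<Longrightarrow> j \<le> r i \<longleftrightarrow> i \<le> r j"
begin

definition boxes :: "(nat \<times> nat) set" where
  "boxes = {(i, j). 1 \<le> i \<and> 1 \<le> j \<and> j \<le> r i}"

definition diag_rows :: "nat set" where
  "diag_rows = {i. 1 \<le> i \<and> i \<le> r i}"

text \<open>The Frobenius coordinates; by symmetry arms and legs agree, so one set suffices.\<close>

definition arms :: "nat set" where
  "arms = (\<lambda>i. r i - i) ` diag_rows"

definition beads :: "int set" where
  "beads = (\<lambda>i. int (r i) - int i) ` {1..}"

lemma antimono: "1 \<le> i \<Longrightarrow> i \<le> i' \<Longrightarrow> r i' \<le> r i"
proof (cases "r i' = 0")
  case False
  assume "1 \<le> i" "i \<le> i'"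
  then have "i' \<le> r (r i')" using sym[of i' "r i'"] False by simp
  then show ?thesis using sym[of i "r i'"] \<open>1 \<le> i\<close> \<open>i \<le> i'\<close> False by simp
qed simp

lemma row_le: "1 \<le> i \<Longrightarrow> r i \<le> r 1"
  by (rule antimono) auto

lemma row_pos_iff: "1 \<le> i \<Longrightarrow> 1 \<le> r i \<longleftrightarrow> i \<le> r 1"
  using sym[of i 1] by simp

lemma boxes_sym: "(i, j) \<in> boxes \<longleftrightarrow> (j, i) \<in> boxes"
  using sym by (auto simp: boxes_def)

lemma finite_boxes: "finite boxes"
proof -
  have "i \<le> r 1 \<and> j \<le> r 1" if "(i, j) \<in> boxes" for i j
    using that row_le[of i] row_pos_iff[of i] by (auto simp: boxes_def)
  then have "boxes \<subseteq> {..r 1} \<times> {..r 1}" by auto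
  then show ?thesis by (rule finite_subset) simp
qed

lemma finite_diag_rows: "finite diag_rows"
proof (rule finite_subset)
  show "diag_rows \<subseteq> {..r 1}"
  proof
    fix i assume "i \<in> diag_rows"
    then show "i \<in> {..r 1}" using row_le[of i] by (simp add: diag_rows_def)
  qed
qed simp

lemma finite_arms: "finite arms"
  by (simp add: arms_def finite_diag_rows)

lemma bead_less: "1 \<le> i \<Longrightarrow> i < i' \<Longrightarrow> int (r i') - int i' < int (r i) - int i"
  using antimono[of i i'] by simp

lemma bead_eq_iff: "1 \<le> i \<Longrightarrow> 1 \<le> i' \<Longrightarrow> int (r i') - int i' = int (r i) - int i \<longleftrightarrow> i = i'"
  using bead_less[of i i'] bead_less[of i' i] by (cases i i' rule: linorder_cases) auto

lemma inj_on_arm: "inj_on (\<lambda>i. r i - i) diag_rows"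
proof (rule inj_onI)
  fix i i' assume i: "i \<in> diag_rows" "i' \<in> diag_rows" "r i - i = r i' - i'"
  then have "int (r i') - int i' = int (r i) - int i" unfolding diag_rows_def by auto
  then show "i = i'" using bead_eq_iff[of i i'] i by (simp add: diag_rows_def)
qed

text \<open>If both were beads, then \<open>r i + r j = i + j - 1\<close>, but by symmetry the sum
  is at least \<open>i + j\<close> or at most \<open>i + j - 2\<close>. Conversely, for a gap
  \<open>u\<close> let \<open>i\<close> be the first row with bead below \<open>u\<close> and
  \<open>j = u + i\<close>; symmetry then gives \<open>r j = i - 1\<close>.\<close>

lemma beads_mirror: "- 1 - u \<in> beads \<longleftrightarrow> u \<notin> beads"
proof
  assume "- 1 - u \<in> beads"
  then obtain j where j: "1 \<le> j" "- 1 - u = int (r j) - int j" by (auto simp: beads_def)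
  show "u \<notin> beads"
  proof
    assume "u \<in> beads"
    then obtain i where i: "1 \<le> i" "u = int (r i) - int i" by (auto simp: beads_def)
    have "int (r i) + int (r j) = int i + int j - 1" using i j by simp
    then show False using sym[of i j] i(1) j(1) by linarith
  qed
next
  assume u: "u \<notin> beads"
  define P where "P = (\<lambda>i. 1 \<le> i \<and> int (r i) - int i < u)"
  \<comment> \<open>No row exceeds \<open>r 1\<close>, so the bead of this row is at most
    \<open>-|u| - 1\<close>.\<close>
  have "P (r 1 + nat \<bar>u\<bar> + 1)"
    using row_le[of "r 1 + nat \<bar>u\<bar> + 1"] by (simp add: P_def)
  define i where "i = (LEAST i. P i)"
  have "P i" unfolding i_def by (rule LeastI) fact
  then have i: "1 \<le> i" "int (r i) < u + int i" by (simp_all add: P_def)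
  define j where "j = nat (u + int i)"
  have j: "1 \<le> j" "int j = u + int i" "r i < j" using i by (simp_all add: j_def)
  have "r j < i" using sym[of i j] i j by simp
  moreover have "i - 1 \<le> r j"
  proof (cases "i = 1")
    case False
    then have "\<not> P (i - 1)" unfolding i_def[symmetric]
      using not_less_Least[of "i - 1" P] i(1) i_def by simp
    then have "\<not> int (r (i - 1)) - int (i - 1) < u" using False i(1) by (simp add: P_def)
    then have "u \<le> int (r (i - 1)) - int (i - 1)" by linarith
    moreover have "int (r (i - 1)) - int (i - 1) \<in> beads"
      unfolding beads_def using False i(1) by (intro imageI) simp
    then have "u \<noteq> int (r (i - 1)) - int (i - 1)" using u by blast
    ultimately have "j \<le> r (i - 1)" using j i by linarith
    then show ?thesis using sym[of "i - 1" j] False i(1) j by simp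
  qed simp
  ultimately have "- 1 - u = int (r j) - int j" using j i by linarith
  then show "- 1 - u \<in> beads" using j(1) by (auto simp: beads_def)
qed

text \<open>The nonnegative beads are the arms of the diagonal rows, and on both sides reflection
  determines the negative half.\<close>

lemma sym_maya_arms: "sym_maya arms = beads"
proof -
  have nonneg: "a \<in> arms \<longleftrightarrow> int a \<in> beads" for a
  proof
    assume "a \<in> arms"
    then obtain i where "1 \<le> i" "i \<le> r i" "a = r i - i" by (auto simp: arms_def diag_rows_def)
    then show "int a \<in> beads" by (force simp: beads_def of_nat_diff)
  next
    assume "int a \<in> beads"
    then obtain i where "1 \<le> i" "int a = int (r i) - int i" by (auto simp: beads_def)
    then show "a \<in> arms" by (auto simp: arms_def diag_rows_def intro!: rev_image_eqI[of i])
  qed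
  have "u \<in> sym_maya arms \<longleftrightarrow> u \<in> beads" for u
  proof (cases "0 \<le> u")
    case True
    then show ?thesis using nonneg[of "nat u"] by (simp add: sym_maya_def bead_index_def)
  next
    case False
    then have "u \<in> sym_maya arms \<longleftrightarrow> nat (- 1 - u) \<notin> arms"
      by (simp add: sym_maya_def bead_index_def)
    also have "\<dots> \<longleftrightarrow> - 1 - u \<notin> beads" using False by (simp add: nonneg)
    finally show ?thesis by (simp add: beads_mirror)
  qed
  then show ?thesis by blast
qed

definition hook :: "nat \<times> nat \<Rightarrow> nat" where
  "hook = (\<lambda>(i, j). (r i - j) + (r j - i) + 1)"

text \<open>The bead of row \<open>i\<close> is \<open>r i - i\<close> and the gap of column \<open>j\<close> is \<open>j - 1 - r j\<close>.\<close>

lemma bij_betw_boxes_inversions: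
  "bij_betw (\<lambda>(i, j). (int j - 1 - int (r j), int (r i) - int i))
     {p \<in> boxes. t dvd hook p} (inversions t beads)" (is "bij_betw ?f ?B _")
proof -
  have eq: "int (hook (i, j)) = (int (r i) - int i) - (int j - 1 - int (r j))" if "(i, j) \<in> boxes" for i j
    using that sym[of i j] by (auto simp: hook_def boxes_def of_nat_diff)
  \<comment> \<open>Column \<open>j\<close> is as long as row \<open>j\<close>, so its gap is the
    mirror image of the bead of row \<open>j\<close>.\<close>
  have gap: "int j - 1 - int (r j) \<notin> beads" if "1 \<le> j" for j
    using beads_mirror[of "int j - 1 - int (r j)"] that by (force simp: beads_def)
  have "inj_on ?f ?B"
  proof (rule inj_onI, clarify)
    fix i j i' j'
    assume "(i, j) \<in> boxes" "(i', j') \<in> boxes"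
      and "int j - 1 - int (r j) = int j' - 1 - int (r j')" "int (r i) - int i = int (r i') - int i'"
    then show "i = i' \<and> j = j'"
      using bead_eq_iff[of i i'] bead_eq_iff[of j j'] by (auto simp: boxes_def)
  qed
  moreover have "?f ` ?B = inversions t beads"
  proof (intro equalityI subsetI)
    fix x assume "x \<in> ?f ` ?B"
    then obtain i j where x: "x = (int j - 1 - int (r j), int (r i) - int i)"
      and ij: "(i, j) \<in> boxes" "t dvd hook (i, j)" by auto
    have "0 < int (hook (i, j))" by (simp add: hook_def)
    moreover have "int t dvd int (hook (i, j))" using ij(2) by simp
    ultimately show "x \<in> inversions t beads"
      using ij(1) gap[of j] unfolding x eq[OF ij(1)] inversions_def by (auto simp: boxes_def beads_def)
  next
    fix x assume "x \<in> inversions t beads"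
    then obtain v u where x: "x = (v, u)" "v < u" "v \<notin> beads" "u \<in> beads" "int t dvd u - v"
      by (auto simp: inversions_def)
    obtain i where i: "1 \<le> i" "u = int (r i) - int i" using x(4) by (auto simp: beads_def)
    have "- 1 - v \<in> beads" using x(3) beads_mirror by blast
    then obtain j where j: "1 \<le> j" "- 1 - v = int (r j) - int j" by (auto simp: beads_def)
    have box: "(i, j) \<in> boxes" using sym[of i j] i j x(2) by (auto simp: boxes_def)
    have v: "v = int j - 1 - int (r j)" using j by simp
    have "int t dvd int (hook (i, j))" using x(5) eq[OF box] i v by simp
    then have "(i, j) \<in> ?B" using box by simp
    then show "x \<in> ?f ` ?B" using x(1) i v by force
  qed
  ultimately show ?thesis by (simp add: bij_betw_def)
qed

lemma card_hooks: "card {p \<in> boxes. t dvd hook p} = hook_count t arms"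
  using bij_betw_same_card[OF bij_betw_boxes_inversions] by (simp add: hook_count_def sym_maya_arms)

lemma sum_hooks:
  "(\<Sum>p\<in>{p \<in> boxes. t dvd hook p}. g (hook p))
     = (\<Sum>(v, u)\<in>inversions t (sym_maya arms). g (nat (u - v)))"
  unfolding sym_maya_arms sum.reindex_bij_betw[OF bij_betw_boxes_inversions, symmetric]
proof (rule sum.cong[OF refl], clarify)
  fix i j assume "(i, j) \<in> boxes"
  then have "hook (i, j) = nat (int (r i) - int i - (int j - 1 - int (r j)))"
    using sym[of i j] by (auto simp: hook_def boxes_def)
  then show "g (hook (i, j)) = g (nat (int (r i) - int i - (int j - 1 - int (r j))))" by simp
qed

text \<open>Boxes are grouped into principal hooks, whose corners are the diagonal boxes.\<close>

lemma sum_boxes: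
  assumes "\<And>i j. G (i, j) = G (j, i)"
  shows "sum G boxes = (\<Sum>i\<in>diag_rows. (\<Sum>j=i..r i. G (i, j)) + (\<Sum>j\<in>{i<..r i}. G (i, j)) :: int)"
proof -
  \<comment> \<open>\<open>U\<close> covers the boxes on or right of the diagonal; the transpose of
    \<open>V\<close> covers those below it.\<close>
  define U where "U = (SIGMA i:diag_rows. {i..r i})"
  define V where "V = (SIGMA i:diag_rows. {i<..r i})"
  have fin: "finite U" "finite V" using finite_diag_rows by (auto simp: U_def V_def)
  have "boxes = U \<union> prod.swap ` V"
  proof (intro equalityI subsetI)
    fix p assume "p \<in> boxes"
    then obtain i j where p: "p = (i, j)" "(i, j) \<in> boxes" by (cases p) auto
    show "p \<in> U \<union> prod.swap ` V"
    proof (cases "i \<le> j")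
      case True
      then show ?thesis using p by (auto simp: U_def boxes_def diag_rows_def)
    next
      case False
      then have "(j, i) \<in> V" using p boxes_sym[of i j] by (auto simp: V_def boxes_def diag_rows_def)
      then show ?thesis using p by (force intro: image_eqI[of _ _ "(j, i)"])
    qed
  next
    fix p assume "p \<in> U \<union> prod.swap ` V"
    then show "p \<in> boxes"
      using boxes_sym by (auto simp: U_def V_def diag_rows_def boxes_def sym)
  qed
  moreover have "U \<inter> prod.swap ` V = {}" by (auto simp: U_def V_def)
  ultimately have "sum G boxes = sum G U + sum G (prod.swap ` V)"
    using fin by (simp add: sum.union_disjoint)
  also have "sum G (prod.swap ` V) = sum G V"
    by (subst sum.reindex) (auto simp: assms intro!: sum.cong)
  also have "sum G U = (\<Sum>i\<in>diag_rows. \<Sum>j=i..r i. G (i, j))"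
    unfolding U_def using finite_diag_rows by (subst sum.Sigma) auto
  also have "sum G V = (\<Sum>i\<in>diag_rows. \<Sum>j\<in>{i<..r i}. G (i, j))"
    unfolding V_def using finite_diag_rows by (subst sum.Sigma) auto
  finally show ?thesis by (simp add: sum.distrib)
qed

lemma card_boxes: "card boxes = hook_weight arms"
proof -
  have "int (card boxes) = (\<Sum>i\<in>diag_rows. int (2 * (r i - i) + 1))"
    using sum_boxes[of "\<lambda>_. 1"] by (auto simp: diag_rows_def of_nat_diff intro!: sum.cong)
  also have "\<dots> = int (hook_weight arms)"
    unfolding hook_weight_def arms_def sum.reindex[OF inj_on_arm] by simp
  finally show ?thesis by simp
qed

lemma sum_sign_boxes: "(\<Sum>(i, j)\<in>boxes. (-1) ^ (i + j)) = sign_sum arms"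
proof -
  \<comment> \<open>Lengthening arm and leg by one adds two boxes of sign \<open>-(-1)^a\<close>,
    which flips the total \<open>(-1)^a\<close>.\<close>
  have alt: "(\<Sum>j=i..i + a. (-1) ^ (i + j)) + (\<Sum>j\<in>{i<..i + a}. (-1) ^ (i + j)) = ((-1) ^ a :: int)" for i a
  proof (induction a)
    case (Suc a)
    have "{i..i + Suc a} = insert (i + Suc a) {i..i + a}" "{i<..i + Suc a} = insert (i + Suc a) {i<..i + a}"
      by auto
    moreover have "(-1 :: int) ^ (i + (i + Suc a)) = - ((-1) ^ a)"
      by (simp add: minus_one_power_iff)
    ultimately show ?case using Suc by simp
  qed (simp add: minus_one_power_iff)
  have "(\<Sum>(i, j)\<in>boxes. (-1) ^ (i + j)) = (\<Sum>i\<in>diag_rows.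
      (\<Sum>j=i..r i. (-1) ^ (i + j)) + (\<Sum>j\<in>{i<..r i}. (-1 :: int) ^ (i + j)))"
    using sum_boxes[of "\<lambda>(i, j). (-1) ^ (i + j)"] by (simp add: add.commute)
  also have "\<dots> = (\<Sum>i\<in>diag_rows. (-1) ^ (r i - i))"
  proof (rule sum.cong[OF refl])
    fix i assume "i \<in> diag_rows"
    then show "(\<Sum>j=i..r i. (-1) ^ (i + j)) + (\<Sum>j\<in>{i<..r i}. (-1) ^ (i + j)) = (-1 :: int) ^ (r i - i)"
      using alt[of i "r i - i"] by (simp add: diag_rows_def)
  qed
  also have "\<dots> = sign_sum arms"
    unfolding sign_sum_def arms_def sum.reindex[OF inj_on_arm] by simp
  finally show ?thesis .
qed

text \<open>The rows whose arm is at least \<open>j - i\<close> form an initial segment, so counting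
  such arms decides whether row \<open>i\<close> is among them. Hence the arms determine the
  diagram.\<close>

lemma box_iff_arms:
  assumes "1 \<le> i" "i \<le> j"
  shows "(i, j) \<in> boxes \<longleftrightarrow> i \<le> card {a \<in> arms. j - i \<le> a}"
proof -
  define S where "S = {k. 1 \<le> k \<and> k + (j - i) \<le> r k}"
  have sub: "S \<subseteq> diag_rows" by (auto simp: S_def diag_rows_def)
  have "{a \<in> arms. j - i \<le> a} = (\<lambda>k. r k - k) ` S"
    by (auto simp: arms_def S_def diag_rows_def image_iff)
  moreover have "inj_on (\<lambda>k. r k - k) S" using inj_on_arm sub by (rule inj_on_subset)
  ultimately have "card {a \<in> arms. j - i \<le> a} = card S" by (simp add: card_image)
  moreover have "i \<le> card S \<longleftrightarrow> i + (j - i) \<le> r i"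
    unfolding S_def
  proof (rule initial_segment_iff)
    show "finite {k. 1 \<le> k \<and> k + (j - i) \<le> r k}"
      using sub finite_diag_rows unfolding S_def by (rule finite_subset)
    show "y + (j - i) \<le> r y" if "x + (j - i) \<le> r x" "1 \<le> y" "y \<le> x" for x y
      using that antimono[of y x] by simp
  qed fact
  ultimately show ?thesis using assms by (simp add: boxes_def)
qed

end

section \<open>Symmetric diagrams correspond to finite sets of arms\<close>

lemma symmetric_rows_arms_inject:
  assumes r: "symmetric_rows r" and r': "symmetric_rows r'"
    and eq: "symmetric_rows.arms r = symmetric_rows.arms r'" and "1 \<le> i"
  shows "r i = r' i"
proof -
  interpret r: symmetric_rows r by fact
  interpret r': symmetric_rows r' by fact
  have le: "(k, l) \<in> r.boxes \<longleftrightarrow> (k, l) \<in> r'.boxes" if "1 \<le> k" "k \<le> l" for k l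
    using r.box_iff_arms[OF that] r'.box_iff_arms[OF that] eq by simp
  have "j \<le> r i \<longleftrightarrow> j \<le> r' i" if "1 \<le> j" for j
  proof -
    have "(i, j) \<in> r.boxes \<longleftrightarrow> (i, j) \<in> r'.boxes"
      using le[of i j] le[of j i] r.boxes_sym[of i j] r'.boxes_sym[of i j] that \<open>1 \<le> i\<close>
      by (cases "i \<le> j") auto
    then show ?thesis using that \<open>1 \<le> i\<close> by (simp add: r.boxes_def r'.boxes_def)
  qed
  from this[of "r i"] this[of "r' i"] show ?thesis by (cases "r i"; cases "r' i") auto
qed

lemma symmetric_rows_of_arms:
  assumes "finite A"
  obtains r where "symmetric_rows r" "symmetric_rows.arms r = A"
proof -
  define c where "c m = card {a \<in> A. m \<le> a}" for m
  have c_antimono: "c n \<le> c m" if "m \<le> n" for m n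
    unfolding c_def using assms that by (intro card_mono) auto
  have c_Suc: "c m = c (Suc m) + (if m \<in> A then 1 else 0)" for m
  proof (cases "m \<in> A")
    case True
    then have "{a \<in> A. m \<le> a} = insert m {a \<in> A. Suc m \<le> a}" by auto
    then show ?thesis using True assms by (simp add: c_def)
  next
    case False
    then have "m \<le> a \<longleftrightarrow> Suc m \<le> a" if "a \<in> A" for a
      using that by (cases "a = m") auto
    then have "{a \<in> A. m \<le> a} = {a \<in> A. Suc m \<le> a}" by blast
    then show ?thesis using False by (simp add: c_def)
  qed
  obtain M where "\<forall>a\<in>A. a < M" using assms finite_nat_set_iff_bounded by blast
  then have "{a \<in> A. M \<le> a} = {}" by fastforce
  then have "c M = 0" by (simp only: c_def card.empty)
  then have M: "c m = 0" if "M \<le> m" for m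
    using c_antimono[OF that] by simp
  \<comment> \<open>The criterion of \<open>box_iff_arms\<close>, extended by reflection below the
    diagonal, becomes the definition of the diagram.\<close>
  define D where "D i j \<longleftrightarrow> (if i \<le> j then i \<le> c (j - i) else j \<le> c (i - j))" for i j
  define r where "r i = card {j. 1 \<le> j \<and> D i j}" for i
  have D_down: "D i j" if "D i (Suc j)" for i j
  proof (cases "i \<le> j")
    case True
    moreover have "c (Suc j - i) \<le> c (j - i)" by (intro c_antimono diff_le_mono) simp
    ultimately show ?thesis using that by (simp add: D_def)
  next
    case False
    \<comment> \<open>Below the diagonal a step left changes the argument of \<open>c\<close> in the
      wrong direction, but \<open>c\<close> drops by at most one per step, which the smaller
      \<open>j\<close> makes up for.\<close>
    then have "Suc j \<le> c (i - Suc j)" using that by (simp add: D_def split: if_splits)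
    also have "\<dots> \<le> c (i - j) + 1" using c_Suc[of "i - Suc j"] False by (simp add: Suc_diff_Suc)
    finally show ?thesis using False by (simp add: D_def)
  qed
  have D_down': "D i y" if "D i x" "y \<le> x" for i x y
    using that(2,1) by (induction rule: inc_induct) (use D_down in auto)
  have r_iff: "j \<le> r i \<longleftrightarrow> D i j" if "1 \<le> i" "1 \<le> j" for i j
  proof -
    have "j \<le> i + M" if "D i j" for j
    proof (rule ccontr)
      assume "\<not> j \<le> i + M"
      then have "i < j" "c (j - i) = 0" using M[of "j - i"] by simp_all
      then show False using that \<open>1 \<le> i\<close> by (simp add: D_def)
    qed
    then have "{j. 1 \<le> j \<and> D i j} \<subseteq> {..i + M}" by auto
    then have fin: "finite {j. 1 \<le> j \<and> D i j}" by (rule finite_subset) simp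
    have "j \<le> card {j. 1 \<le> j \<and> D i j} \<longleftrightarrow> D i j"
      by (rule initial_segment_iff[where P = "D i", OF fin _ \<open>1 \<le> j\<close>]) (rule D_down')
    then show ?thesis by (simp only: r_def)
  qed
  have rows: "symmetric_rows r"
    by unfold_locales (auto simp: r_iff D_def)
  then interpret symmetric_rows r .
  have "a \<in> arms \<longleftrightarrow> a \<in> A" for a
  proof -
    have "a \<in> arms \<longleftrightarrow> (\<exists>i. 1 \<le> i \<and> i \<le> r i \<and> a = r i - i)"
      by (auto simp: arms_def diag_rows_def)
    \<comment> \<open>Some row ends exactly \<open>a\<close> boxes right of the diagonal iff
      \<open>c\<close> drops after \<open>a\<close>, and \<open>c\<close> drops exactly at the
      elements of \<open>A\<close>.\<close>
    also have "\<dots> \<longleftrightarrow> (\<exists>i. 1 \<le> i \<and> i + a \<le> r i \<and> \<not> Suc (i + a) \<le> r i)"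
      by (intro ex_cong1) linarith
    also have "\<dots> \<longleftrightarrow> (\<exists>i. 1 \<le> i \<and> i \<le> c a \<and> \<not> i \<le> c (Suc a))"
      by (intro ex_cong1 conj_cong refl) (simp_all add: r_iff D_def Suc_diff_le)
    also have "\<dots> \<longleftrightarrow> a \<in> A"
    proof (cases "a \<in> A")
      case True
      then have "1 \<le> c a \<and> c a \<le> c a \<and> \<not> c a \<le> c (Suc a)" using c_Suc[of a] by simp
      then show ?thesis using True by blast
    next
      case False
      then show ?thesis using c_Suc[of a] by simp
    qed
    finally show ?thesis .
  qed
  then show ?thesis using that[OF rows] by blast
qed

section \<open>Self-conjugate partitions\<close>

definition row_length :: "nat list \<Rightarrow> nat \<Rightarrow> nat" where
  "row_length \<mu> i = (if 1 \<le> i \<and> i \<le> length \<mu> then \<mu> ! (i - 1) else 0)"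

lemma row_Cons: "1 \<le> i \<Longrightarrow> row_length (p # ps) (Suc i) = row_length ps i"
  by (auto simp: row_length_def nth_Cons')

lemma row_Cons_1 [simp]: "row_length (p # ps) (Suc 0) = p"
  by (simp add: row_length_def)

lemma row_Nil [simp]: "row_length [] i = 0"
  by (simp add: row_length_def)

lemma nat_eqI_ge:
  fixes m n :: nat
  assumes "\<And>i. 1 \<le> i \<Longrightarrow> i \<le> m \<longleftrightarrow> i \<le> n"
  shows "m = n"
  using assms[of m] assms[of n] by (cases m; cases n) auto

text \<open>The parts are nonincreasing, so those that are at least \<open>j\<close> form a prefix
  of the list.\<close>

lemma le_row_iff:
  assumes "is_partition \<mu>" "1 \<le> i" "1 \<le> j"
  shows "j \<le> row_length \<mu> i \<longleftrightarrow> i \<le> length (filter (\<lambda>p. j \<le> p) \<mu>)"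
  using assms
proof (induction \<mu> arbitrary: i)
  case (Cons p ps)
  then have ps: "is_partition ps" "\<forall>x\<in>set ps. x \<le> p" by (auto simp: is_partition_def)
  show ?case
  proof (cases "i = 1")
    case True
    then show ?thesis
      using ps(2) by (cases "filter (\<lambda>p. j \<le> p) ps") (auto simp: filter_empty_conv dest: filter_eq_ConsD)
  next
    case False
    then obtain k where k: "i = Suc k" "1 \<le> k" using Cons.prems(2) by (cases i) auto
    have eq: "j \<le> row_length (p # ps) i \<longleftrightarrow> k \<le> length (filter (\<lambda>p. j \<le> p) ps)"
      using Cons.IH[OF ps(1) k(2)] Cons.prems(3) k by (simp add: row_Cons)
    show ?thesis
    proof (cases "j \<le> p")
      case True
      then show ?thesis using eq k by simp
    next
      case False
      then have "filter (\<lambda>p. j \<le> p) ps = []" using ps(2) by (auto simp: filter_empty_conv)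
      then show ?thesis using False eq k by simp
    qed
  qed
qed simp

lemma row_pos_iff: "is_partition \<mu> \<Longrightarrow> 1 \<le> i \<Longrightarrow> 1 \<le> row_length \<mu> i \<longleftrightarrow> i \<le> length \<mu>"
  using nth_mem[of "i - 1" \<mu>] by (auto simp: row_length_def is_partition_def Suc_le_eq)

text \<open>Within the list this is an entry of \<open>conjugate\<close>; beyond it both sides are
  0, since the length equals the largest part.\<close>

lemma row_self_conjugate:
  assumes "\<mu> \<in> self_conjugate_partitions" "1 \<le> j"
  shows "row_length \<mu> j = length (filter (\<lambda>p. j \<le> p) \<mu>)"
proof (cases "\<mu> = []")
  case False
  have part: "is_partition \<mu>" and conj: "conjugate \<mu> = \<mu>"
    using assms(1) by (auto simp: self_conjugate_partitions_def)
  have len: "length \<mu> = hd \<mu>"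
    using arg_cong[OF conj, of length] False by (simp add: conjugate_def del: upt_Suc)
  show ?thesis
  proof (cases "j \<le> length \<mu>")
    case True
    then have "[1..<Suc (hd \<mu>)] ! (j - 1) = j" "j - 1 < length [1..<Suc (hd \<mu>)]"
      using assms(2) len by (simp_all add: nth_upt del: upt_Suc)
    then have "conjugate \<mu> ! (j - 1) = length (filter (\<lambda>p. j \<le> p) \<mu>)"
      using False by (simp only: conjugate_def if_False nth_map)
    then show ?thesis using conj True assms(2) by (simp add: row_length_def)
  next
    case gt: False
    have "row_length \<mu> 1 = hd \<mu>" using False by (cases \<mu>) auto
    then have "\<not> 1 \<le> length (filter (\<lambda>p. j \<le> p) \<mu>)"
      using le_row_iff[OF part, of 1 j] assms(2) gt len by simp
    then show ?thesis using gt by (simp add: row_length_def not_le)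
  qed
qed simp

lemma symmetric_rows_row:
  assumes "\<mu> \<in> self_conjugate_partitions"
  shows "symmetric_rows (row_length \<mu>)"
proof
  fix i j :: nat assume "1 \<le> i" "1 \<le> j"
  moreover have "is_partition \<mu>" using assms by (simp add: self_conjugate_partitions_def)
  ultimately show "j \<le> row_length \<mu> i \<longleftrightarrow> i \<le> row_length \<mu> j"
    using le_row_iff[of \<mu> i j] row_self_conjugate[OF assms, of j] by simp
qed

definition diag_arms :: "nat list \<Rightarrow> nat set" where
  "diag_arms \<mu> = symmetric_rows.arms (row_length \<mu>)"

context
  fixes \<mu> :: "nat list"
  assumes sc: "\<mu> \<in> self_conjugate_partitions"
begin

interpretation symmetric_rows "row_length \<mu>"
  by (rule symmetric_rows_row[OF sc])

lemma ferrers_eq_boxes: "ferrers \<mu> = boxes"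
  by (auto simp: ferrers_def boxes_def row_length_def split: if_splits)

lemma sum_list_eq: "sum_list \<mu> = hook_weight (diag_arms \<mu>)"
proof -
  have "ferrers \<mu> = (SIGMA i:{1..length \<mu>}. {1..\<mu> ! (i - 1)})" by (auto simp: ferrers_def)
  then have "card (ferrers \<mu>) = (\<Sum>i=1..length \<mu>. \<mu> ! (i - 1))" by simp
  also have "\<dots> = sum_list \<mu>"
    by (simp add: sum_list_sum_nth sum.atLeast1_atMost_eq atLeast0LessThan)
  finally show ?thesis by (simp add: ferrers_eq_boxes card_boxes diag_arms_def)
qed

lemma BG_rank_eq: "BG_rank \<mu> = sign_sum (diag_arms \<mu>)"
  by (simp add: BG_rank_def ferrers_eq_boxes sum_sign_boxes diag_arms_def)

lemma hook_length_eq: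
  assumes "p \<in> boxes"
  shows "hook_length \<mu> p = hook p"
proof -
  obtain i j where p: "p = (i, j)" by (cases p)
  have "conjugate \<mu> = \<mu>" using sc by (simp add: self_conjugate_partitions_def)
  moreover have "row_length \<mu> i = \<mu> ! (i - 1)" "row_length \<mu> j = \<mu> ! (j - 1)"
    using assms p boxes_sym[of i j] by (auto simp: boxes_def row_length_def split: if_splits)
  ultimately show ?thesis using p by (simp add: hook_length_def hook_def)
qed

lemma hooks_eq: "hooks t \<mu> = image_mset hook (mset_set {p \<in> boxes. t dvd hook p})"
proof -
  have "image_mset (hook_length \<mu>) (mset_set boxes) = image_mset hook (mset_set boxes)"
    by (rule image_mset_cong) (simp add: hook_length_eq finite_boxes)
  then show ?thesis
    by (simp add: hooks_def ferrers_eq_boxes filter_mset_image_mset finite_boxes)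
qed

lemma size_hooks_eq: "size (hooks t \<mu>) = hook_count t (diag_arms \<mu>)"
  by (simp add: hooks_eq card_hooks diag_arms_def)

lemma sum_hooks_eq:
  "(\<Sum>h\<in>#hooks t \<mu>. g h) = (\<Sum>(v, u)\<in>inversions t (sym_maya (diag_arms \<mu>)). g (nat (u - v)))"
proof -
  have "(\<Sum>h\<in>#hooks t \<mu>. g h) = (\<Sum>p\<in>{p \<in> boxes. t dvd hook p}. g (hook p))"
    by (simp add: hooks_eq sum_unfold_sum_mset image_mset.compositionality o_def)
  then show ?thesis by (simp only: sum_hooks diag_arms_def)
qed

end

section \<open>The bijection between self-conjugate partitions and finite sets of arms\<close>

lemma diag_arms_inject:
  assumes "\<mu> \<in> self_conjugate_partitions" "\<nu> \<in> self_conjugate_partitions" "diag_arms \<mu> = diag_arms \<nu>"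
  shows "\<mu> = \<nu>"
proof -
  have part: "is_partition \<mu>" "is_partition \<nu>"
    using assms by (auto simp: self_conjugate_partitions_def)
  have row: "row_length \<mu> i = row_length \<nu> i" if "1 \<le> i" for i
    using symmetric_rows_arms_inject[OF symmetric_rows_row[OF assms(1)] symmetric_rows_row[OF assms(2)] _ that]
      assms(3) by (simp add: diag_arms_def)
  have len: "length \<mu> = length \<nu>"
  proof (rule nat_eqI_ge)
    fix i :: nat assume "1 \<le> i"
    then show "i \<le> length \<mu> \<longleftrightarrow> i \<le> length \<nu>"
      using row[of i] row_pos_iff[of _ i] part by metis
  qed
  show ?thesis
  proof (rule nth_equalityI[OF len])
    fix i assume "i < length \<mu>"
    then show "\<mu> ! i = \<nu> ! i" using row[of "Suc i"] len by (simp add: row_length_def)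
  qed
qed

lemma diag_arms_surj:
  assumes "finite A"
  obtains \<mu> where "\<mu> \<in> self_conjugate_partitions" "diag_arms \<mu> = A"
proof -
  obtain r where r: "symmetric_rows r" "symmetric_rows.arms r = A"
    using symmetric_rows_of_arms[OF assms] by blast
  interpret symmetric_rows r by fact
  \<comment> \<open>By symmetry row \<open>i\<close> is nonempty exactly for
    \<open>i \<le> r 1\<close>, so only zero rows are dropped.\<close>
  define \<mu> where "\<mu> = map r [1..<Suc (r 1)]"
  have len: "length \<mu> = r 1" by (simp add: \<mu>_def)
  have nth: "\<mu> ! i = r (Suc i)" if "i < r 1" for i
    using that by (simp add: \<mu>_def nth_map nth_upt del: upt_Suc)
  have part: "is_partition \<mu>"
    unfolding is_partition_def sorted_wrt_iff_nth_less
  proof (intro conjI allI impI ballI)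
    fix i j assume "i < j" "j < length \<mu>"
    then show "\<mu> ! j \<le> \<mu> ! i" using antimono[of "Suc i" "Suc j"] by (simp add: nth len)
  next
    fix p assume "p \<in> set \<mu>"
    then obtain i where "i < r 1" "p = r (Suc i)" by (auto simp: in_set_conv_nth len nth)
    then show "0 < p" using row_pos_iff[of "Suc i"] by simp
  qed
  have row: "row_length \<mu> i = r i" if "1 \<le> i" for i
  proof (cases "i \<le> r 1")
    case True
    then show ?thesis using that nth[of "i - 1"] by (simp add: row_length_def len)
  next
    case False
    then have "r i = 0" using row_pos_iff[OF that] by simp
    then show ?thesis using False by (simp add: row_length_def len)
  qed
  have filt: "length (filter (\<lambda>p. j \<le> p) \<mu>) = r j" if "1 \<le> j" for j
  proof (rule nat_eqI_ge)
    fix i :: nat assume "1 \<le> i"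
    then show "i \<le> length (filter (\<lambda>p. j \<le> p) \<mu>) \<longleftrightarrow> i \<le> r j"
      using le_row_iff[OF part, of i j] row[of i] sym[of i j] that by simp
  qed
  have "conjugate \<mu> = \<mu>"
  proof (cases "r 1 = 0")
    case True
    then show ?thesis by (simp add: \<mu>_def conjugate_def)
  next
    case False
    then have ne: "\<mu> \<noteq> []" using len by auto
    then have "hd \<mu> = r 1" using False nth[of 0] by (simp add: hd_conv_nth)
    then have "conjugate \<mu> = map (\<lambda>j. length (filter (\<lambda>p. j \<le> p) \<mu>)) [1..<Suc (r 1)]"
      using ne by (simp add: conjugate_def del: upt_Suc)
    also have "\<dots> = map r [1..<Suc (r 1)]"
      by (rule map_cong[OF refl]) (simp add: filt del: upt_Suc)
    finally show ?thesis by (simp only: \<mu>_def)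
  qed
  then have sc: "\<mu> \<in> self_conjugate_partitions" using part by (simp add: self_conjugate_partitions_def)
  interpret m: symmetric_rows "row_length \<mu>" by (rule symmetric_rows_row[OF sc])
  have "m.diag_rows = diag_rows" by (auto simp: m.diag_rows_def diag_rows_def row)
  then have "m.arms = arms" unfolding m.arms_def arms_def
    by (intro image_cong) (auto simp: row diag_rows_def)
  then have "diag_arms \<mu> = A" using r(2) by (simp add: diag_arms_def)
  with sc that show ?thesis by blast
qed

lemma bij_betw_diag_arms:
  "bij_betw diag_arms {\<mu> \<in> self_conjugate_partitions. sum_list \<mu> = n} (of_weight n)"
proof (rule bij_betw_imageI)
  show "inj_on diag_arms {\<mu> \<in> self_conjugate_partitions. sum_list \<mu> = n}"
    by (rule inj_onI) (auto intro: diag_arms_inject)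
  show "diag_arms ` {\<mu> \<in> self_conjugate_partitions. sum_list \<mu> = n} = of_weight n"
  proof (intro equalityI subsetI)
    fix A assume "A \<in> diag_arms ` {\<mu> \<in> self_conjugate_partitions. sum_list \<mu> = n}"
    then show "A \<in> of_weight n"
      using symmetric_rows.finite_arms[OF symmetric_rows_row]
      by (auto simp: of_weight_def sum_list_eq diag_arms_def)
  next
    fix A assume A: "A \<in> of_weight n"
    then obtain \<mu> where "\<mu> \<in> self_conjugate_partitions" "diag_arms \<mu> = A"
      using diag_arms_surj[of A] by (auto simp: of_weight_def)
    then show "A \<in> diag_arms ` {\<mu> \<in> self_conjugate_partitions. sum_list \<mu> = n}"
      using A by (auto simp: of_weight_def sum_list_eq intro!: image_eqI[of _ _ \<mu>])
  qed
qed

lemma finite_self_conjugate_partitions_of: "finite {\<mu> \<in> self_conjugate_partitions. sum_list \<mu> = n}"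
  using bij_betw_finite[OF bij_betw_diag_arms, of n] by simp

section \<open>The logarithmic derivative\<close>

text \<open>Characteristic zero allows the factor \<open>m\<close> to be cancelled when the
  recursion for the coefficients is solved.\<close>

instance fract :: ("{idom, ring_char_0}") ring_char_0
proof
  show "inj (of_nat :: nat \<Rightarrow> 'a fract)"
    by (rule injI) (simp add: of_nat_fract eq_fract)
qed

instance fract :: ("{idom, ring_char_0}") field_char_0 ..

lemma fps_mult_nth_cong:
  fixes u f g :: "'a::comm_ring_1 fps"
  assumes "\<And>i. i \<le> n \<Longrightarrow> f $ i = g $ i"
  shows "(u * f) $ n = (u * g) $ n"
  using assms by (simp add: fps_mult_nth)

text \<open>The Lambert series terms of \<open>- X E' / E\<close> for the Euler product
  \<open>E\<close>.\<close>

definition lambert_part :: "nat \<Rightarrow> 'a::field fps" where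
  "lambert_part k = of_nat k * fps_X ^ k * inverse (1 - fps_X ^ k)"

text \<open>One step of the geometric series, in the same shape as the ribbon relation
  \<open>F_k = y^k (F_k + t k F)\<close>.\<close>

lemma lambert_part_eq:
  assumes "0 < k"
  shows "lambert_part k = fps_X ^ k * (lambert_part k + of_nat k :: 'a::field fps)"
proof -
  let ?U = "1 - fps_X ^ k :: 'a fps"
  have "inverse ?U * ?U = 1" using assms by (intro inverse_mult_eq_1) simp
  then have "inverse ?U = 1 + fps_X ^ k * inverse ?U" by (simp add: algebra_simps)
  then have "lambert_part k = of_nat k * fps_X ^ k * (1 + fps_X ^ k * inverse ?U)"
    unfolding lambert_part_def by (rule arg_cong)
  also have "\<dots> = fps_X ^ k * (lambert_part k + of_nat k)"
    by (simp add: lambert_part_def algebra_simps)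
  finally show ?thesis .
qed

lemma euler_product_deriv_finite:
  "fps_X * fps_deriv (\<Prod>j<N. 1 - fps_X ^ Suc j) =
     - (\<Prod>j<N. 1 - fps_X ^ Suc j) * (\<Sum>k=1..N. lambert_part k :: 'a::field fps)"
proof (induction N)
  case (Suc N)
  let ?P = "\<Prod>j<N. 1 - fps_X ^ Suc j :: 'a fps" and ?U = "1 - fps_X ^ Suc N :: 'a fps"
    and ?S = "\<Sum>k=1..N. lambert_part k :: 'a fps"
  have U: "?U * inverse ?U = 1" by (intro inverse_mult_eq_1') simp
  have "fps_deriv ?U = - (of_nat (Suc N) * fps_X ^ N)"
    by (simp add: fps_deriv_power' del: of_nat_Suc power_Suc)
  then have dU: "fps_X * fps_deriv ?U = - (of_nat (Suc N) * fps_X ^ Suc N)"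
    by (simp only: power_Suc mult_minus_right) (simp only: ac_simps)
  have "?U * lambert_part (Suc N) = of_nat (Suc N) * fps_X ^ Suc N * (?U * inverse ?U)"
    unfolding lambert_part_def by (simp only: ac_simps)
  then have L: "?U * lambert_part (Suc N) = of_nat (Suc N) * fps_X ^ Suc N" by (simp only: U mult_1_right)
  have "fps_X * fps_deriv (?P * ?U) = (fps_X * fps_deriv ?P) * ?U + ?P * (fps_X * fps_deriv ?U)"
    by (simp only: fps_deriv_mult distrib_left ac_simps)
  also have "\<dots> = - ?P * ?S * ?U - ?P * (?U * lambert_part (Suc N))"
    by (simp only: Suc.IH dU L) (simp add: algebra_simps)
  also have "\<dots> = - (?P * ?U) * (?S + lambert_part (Suc N))"
    by (simp add: algebra_simps)
  finally show ?case by simp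
qed simp

text \<open>Coefficient \<open>h\<close> of \<open>X f'\<close> is \<open>h\<close> times that of
  \<open>f\<close>, so finitely many factors suffice and no infinite sum has to be
  differentiated.\<close>

lemma euler_product_deriv_nth:
  assumes "h \<le> N"
  shows "(- (fps_X * fps_deriv euler_product)) $ h =
    (euler_product * (\<Sum>k=1..N. lambert_part k :: 'a::field fps)) $ h"
proof -
  let ?P = "\<Prod>j<N. 1 - fps_X ^ Suc j :: 'a fps"
  have eq: "euler_product $ i = ?P $ i" if "i \<le> h" for i
    using that assms by (intro euler_product_nth) simp
  have "(fps_X * fps_deriv euler_product) $ h = (fps_X * fps_deriv ?P) $ h"
    using eq[of h] by (cases h) simp_all
  moreover have "(fps_X * fps_deriv ?P) $ h = - ((\<Sum>k=1..N. lambert_part k) * ?P) $ h"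
    by (simp only: euler_product_deriv_finite) (simp add: mult.commute)
  moreover have "((\<Sum>k=1..N. lambert_part k) * ?P) $ h = ((\<Sum>k=1..N. lambert_part k) * euler_product) $ h"
    using eq by (intro fps_mult_nth_cong) simp
  ultimately show ?thesis by (simp add: mult.commute)
qed

text \<open>The generating function of partitions in \<open>s\<close> colours.\<close>

definition partition_power :: "nat \<Rightarrow> 'a::field fps" where
  "partition_power s = inverse euler_product ^ s"

lemma partition_power_nth_0 [simp]: "partition_power s $ 0 = 1"
  by (simp add: partition_power_def euler_product_def qpochhammer_inf_nth_0 fps_power_zeroth)

text \<open>Coefficient \<open>h\<close> of the logarithmic derivative
  \<open>X p' = s p (L_1 + L_2 + ...)\<close>, where \<open>L_k\<close> is
  \<open>lambert_part k\<close>.\<close>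

lemma partition_power_recursion:
  assumes "h \<le> N"
  shows "of_nat h * partition_power s $ h =
    of_nat s * (\<Sum>k=1..N. (lambert_part k * partition_power s :: 'a::field fps) $ h)"
proof (cases "s = 0")
  case True
  then show ?thesis by (simp add: partition_power_def)
next
  case False
  let ?E = "euler_product :: 'a fps" and ?p = "partition_power s :: 'a fps"
  let ?L = "\<Sum>k=1..N. lambert_part k :: 'a fps"
  have E0: "?E $ 0 \<noteq> 0" by (simp add: euler_product_def qpochhammer_inf_nth_0)
  have inv: "inverse ?E * ?E = 1" using E0 by (rule inverse_mult_eq_1)
  have p: "?p = inverse ?E * inverse ?E ^ (s - 1)"
    using False by (cases s) (simp_all add: partition_power_def)
  have "fps_deriv ?p = of_nat s * (- fps_deriv ?E * (inverse ?E)\<^sup>2) * inverse ?E ^ (s - 1)"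
    unfolding partition_power_def fps_deriv_power' fps_inverse_deriv[OF E0] by simp
  then have dp: "fps_X * fps_deriv ?p = (of_nat s * (?p * inverse ?E)) * (- (fps_X * fps_deriv ?E))"
    unfolding p power2_eq_square by (simp add: algebra_simps)
  have "of_nat h * ?p $ h = (fps_X * fps_deriv ?p) $ h"
    by (cases h) simp_all
  also have "\<dots> = ((of_nat s * (?p * inverse ?E)) * (?E * ?L)) $ h"
    unfolding dp by (rule fps_mult_nth_cong, rule euler_product_deriv_nth) (use assms in simp)
  also have "(of_nat s * (?p * inverse ?E)) * (?E * ?L) = of_nat s * (?p * ?L) * (inverse ?E * ?E)"
    by (simp only: ac_simps)
  also have "\<dots> = fps_const (of_nat s) * (\<Sum>k=1..N. lambert_part k * ?p)"
    by (simp only: inv mult_1_right) (simp add: sum_distrib_left mult.commute fps_of_nat)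
  also have "\<dots> $ h = of_nat s * (\<Sum>k=1..N. (lambert_part k * ?p) $ h)"
    by (simp add: fps_sum_nth)
  finally show ?thesis .
qed

lemma lambert_part_mult_nth:
  assumes "0 < k"
  shows "(lambert_part k * p) $ (h + k) = (lambert_part k * p) $ h + of_nat k * (p :: 'a::field fps) $ h"
    "h < k \<Longrightarrow> (lambert_part k * p) $ h = 0"
proof -
  have "lambert_part k * p = fps_X ^ k * (lambert_part k * p + of_nat k * p)"
    by (subst lambert_part_eq[OF assms]) (simp add: algebra_simps)
  then have *: "(lambert_part k * p) $ n = (fps_X ^ k * (lambert_part k * p + of_nat k * p)) $ n" for n
    by simp
  show "(lambert_part k * p) $ (h + k) = (lambert_part k * p) $ h + of_nat k * p $ h"
    by (subst *) (simp add: fps_X_power_mult_nth flip: fps_of_nat)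
  show "(lambert_part k * p) $ h = 0" if "h < k"
    using that by (subst *) (simp add: fps_X_power_mult_nth)
qed

lemma partition_power_compose:
  fixes y :: "'a::field fps"
  assumes "y $ 0 = 0"
  shows "partition_power s oo y = inverse (qpochhammer_inf y y ^ s)"
proof -
  have "euler_product $ 0 \<noteq> (0 :: 'a)" by (simp add: euler_product_def qpochhammer_inf_nth_0)
  then show ?thesis
    using assms
    by (simp add: partition_power_def fps_compose_power[symmetric] fps_inverse_compose
        euler_product_compose fps_inverse_power)
qed

lemma fps_compose_mult_nth:
  fixes y :: "'a::field fps"
  assumes "y $ 0 = 0"
  shows "((p oo y) * f) $ n = (\<Sum>j=0..n. p $ j * (y ^ j * f) $ n)"
proof -
  have "(p oo y) $ i = (\<Sum>j=0..n. fps_const (p $ j) * y ^ j) $ i" if "i \<le> n" for i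
  proof -
    have "(p oo y) $ i = (\<Sum>j=0..n. p $ j * (y ^ j) $ i)"
      unfolding fps_compose_nth using that fps_power_nth_below[OF assms]
      by (intro sum.mono_neutral_left) auto
    then show ?thesis by (simp add: fps_sum_nth)
  qed
  then have "(f * (p oo y)) $ n = (f * (\<Sum>j=0..n. fps_const (p $ j) * y ^ j)) $ n"
    by (rule fps_mult_nth_cong)
  also have "\<dots> = (\<Sum>j=0..n. (fps_const (p $ j) * (y ^ j * f)) $ n)"
    by (simp add: sum_distrib_left fps_sum_nth ac_simps)
  finally show ?thesis by (simp add: mult.commute)
qed

section \<open>Generating functions\<close>

text \<open>The coefficient of \<open>q^n x^m\<close> in \<open>F\<close>;
  \<open>refined_ribbons\<close> is the corresponding coefficient of \<open>F_k\<close>. Separating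
  the powers of \<open>x\<close> replaces differentiation in \<open>x\<close> by multiplication by
  \<open>m\<close>.\<close>

definition refined_count :: "'a::field_char_0 \<Rightarrow> nat \<Rightarrow> nat \<Rightarrow> nat \<Rightarrow> 'a" where
  "refined_count b t n m = (\<Sum>A\<in>of_weight n. if hook_count t A = m then b powi sign_sum A else 0)"

definition refined_ribbons :: "'a::field_char_0 \<Rightarrow> nat \<Rightarrow> nat \<Rightarrow> nat \<Rightarrow> nat \<Rightarrow> 'a" where
  "refined_ribbons b t k n m = (\<Sum>A\<in>of_weight n.
     (if hook_count t A = m then b powi sign_sum A else 0) * of_nat (card (removable (t * k) A)))"

lemma hook_count_eq_sum:
  assumes "A \<in> of_weight n" "even t" "0 < t"
  shows "hook_count t A = (\<Sum>k=1..n. card (removable (t * k) A))"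
  using sum_inversions[OF assms, of "\<lambda>_. 1 :: nat"] by (simp add: hook_count_def)

text \<open>Every hook divisible by \<open>t\<close> is a removable ribbon of exactly one length
  \<open>t k\<close>; this is \<open>x dF/dx\<close> written as the sum of the
  \<open>F_k\<close>.\<close>

lemma sum_refined_ribbons:
  assumes "even t" "0 < t"
  shows "(\<Sum>k=1..n. refined_ribbons b t k n m) = of_nat m * refined_count b t n m"
proof -
  have "(\<Sum>k=1..n. refined_ribbons b t k n m) = (\<Sum>A\<in>of_weight n.
      (if hook_count t A = m then b powi sign_sum A else 0) * of_nat (\<Sum>k=1..n. card (removable (t * k) A)))"
    unfolding refined_ribbons_def by (subst sum.swap) (simp add: sum_distrib_left)
  also have "\<dots> = (\<Sum>A\<in>of_weight n.
      (if hook_count t A = m then b powi sign_sum A else 0) * of_nat (hook_count t A))"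
    using hook_count_eq_sum[OF _ assms] by (intro sum.cong refl) simp
  also have "\<dots> = of_nat m * refined_count b t n m"
    unfolding refined_count_def sum_distrib_left by (intro sum.cong refl) simp
  finally show ?thesis .
qed

text \<open>Coefficient form of \<open>F_k = y^k (F_k + t k F)\<close>: double counting turns
  removable ribbons into addable ones, of which there are \<open>t k\<close> more.\<close>

lemma refined_ribbons_shift:
  assumes t: "even t" "0 < t" and k: "0 < k"
  shows "refined_ribbons b t k (n + 2 * (t * k)) (m + 2 * k) =
    refined_ribbons b t k n m + of_nat (t * k) * refined_count b t n m"
proof -
  have "refined_ribbons b t k (n + 2 * (t * k)) (m + 2 * k) = (\<Sum>A\<in>of_weight n.
      (if hook_count t A = m then b powi sign_sum A else 0) * of_nat (card (addable (t * k) A)))"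
    unfolding refined_ribbons_def
    using sum_removable_eq_sum_addable[OF t k, where n = n
        and \<phi> = "\<lambda>h g. if h = m + 2 * k then b powi g else 0"] by simp
  also have "\<dots> = (\<Sum>A\<in>of_weight n.
      (if hook_count t A = m then b powi sign_sum A else 0) * (of_nat (card (removable (t * k) A)) + of_nat (t * k)))"
    using card_addable(1) by (intro sum.cong refl) (auto simp: of_weight_def)
  also have "\<dots> = refined_ribbons b t k n m + of_nat (t * k) * refined_count b t n m"
    by (simp only: refined_ribbons_def refined_count_def distrib_left sum.distrib sum_distrib_left mult.commute)
  finally show ?thesis .
qed

lemma refined_ribbons_zero:
  assumes t: "even t" "0 < t" and k: "0 < k" and "n < 2 * (t * k) \<or> m < 2 * k"
  shows "refined_ribbons b t k n m = 0"
  unfolding refined_ribbons_def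
proof (rule sum.neutral, rule ballI)
  fix A assume A: "A \<in> of_weight n"
  have d: "even (t * k)" "0 < t * k" using t k by auto
  have "removable (t * k) A = {} \<or> hook_count t A \<noteq> m"
  proof (cases "n < 2 * (t * k)")
    case True
    then show ?thesis using removable_empty[OF A d] by simp
  next
    case False
    then have "m < 2 * k" using assms(4) by simp
    then show ?thesis using hook_count_slide[of A t k] A t k by (force simp: of_weight_def)
  qed
  then show "(if hook_count t A = m then b powi sign_sum A else 0) * of_nat (card (removable (t * k) A)) = 0"
    by auto
qed

text \<open>Peeling off ribbon pairs lowers \<open>m\<close> by \<open>2 k\<close>, and
  \<open>lambert_part\<close> satisfies the same recursion. The closed form for
  \<open>refined_count\<close> is assumed only below \<open>m\<close>, so that this lemma fits
  inside the induction proving that form.\<close>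

lemma refined_ribbons_eq:
  fixes b :: "'a::field_char_0"
  assumes t: "even t" "0 < t" and k: "0 < k"
    and IH: "\<And>m' n. m' < m \<Longrightarrow> refined_count b t n m' =
      (if even m' \<and> t * m' \<le> n then partition_power (t div 2) $ (m' div 2) * refined_count b t (n - t * m') 0 else 0)"
  shows "refined_ribbons b t k n m = (if even m \<and> t * m \<le> n then
      of_nat t * (lambert_part k * partition_power (t div 2)) $ (m div 2) * refined_count b t (n - t * m) 0 else 0)"
  using IH
proof (induction m arbitrary: n rule: less_induct)
  case (less m)
  let ?p = "partition_power (t div 2) :: 'a fps"
  show ?case
  proof (cases "n < 2 * (t * k) \<or> m < 2 * k")
    case True
    have "(lambert_part k * ?p) $ (m div 2) = 0" if "even m" "t * m \<le> n"
    proof -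
      have "m < 2 * k"
      proof (rule ccontr)
        assume "\<not> m < 2 * k"
        then have "2 * (t * k) \<le> t * m"
          using mult_le_mono2[of "2 * k" m t] by (simp add: ac_simps)
        then show False using True \<open>\<not> m < 2 * k\<close> that(2) by linarith
      qed
      then show ?thesis by (intro lambert_part_mult_nth(2) k) simp
    qed
    then show ?thesis using refined_ribbons_zero[OF t k True, of b] by simp
  next
    case False
    define m' where "m' = m - 2 * k"
    define n' where "n' = n - 2 * (t * k)"
    have mn: "m = m' + 2 * k" "n = n' + 2 * (t * k)" "m' < m"
      using False k by (simp_all add: m'_def n'_def)
    have le: "t * m \<le> n \<longleftrightarrow> t * m' \<le> n'" and diff: "n - t * m = n' - t * m'"
      and ev: "even m \<longleftrightarrow> even m'" and div: "m div 2 = m' div 2 + k"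
      unfolding mn by (simp_all add: algebra_simps)
    have "refined_ribbons b t k n m = refined_ribbons b t k n' m' + of_nat (t * k) * refined_count b t n' m'"
      unfolding mn by (rule refined_ribbons_shift[OF t k])
    also have "refined_ribbons b t k n' m' = (if even m' \<and> t * m' \<le> n' then
        of_nat t * (lambert_part k * ?p) $ (m' div 2) * refined_count b t (n' - t * m') 0 else 0)"
      using mn(3) less.prems by (intro less.IH) auto
    also have "refined_count b t n' m' =
        (if even m' \<and> t * m' \<le> n' then ?p $ (m' div 2) * refined_count b t (n' - t * m') 0 else 0)"
      using mn(3) by (rule less.prems)
    finally show ?thesis
      unfolding le diff ev div lambert_part_mult_nth(1)[OF k] by (simp add: algebra_simps)
  qed
qed

text \<open>Coefficient form of the differential equation in \<open>x\<close>: both sides satisfy the recursion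
  in \<open>m\<close> that expresses \<open>m\<close> times the coefficient through smaller ones.\<close>

lemma refined_count_eq:
  fixes b :: "'a::field_char_0"
  assumes t: "even t" "0 < t"
  shows "refined_count b t n m =
    (if even m \<and> t * m \<le> n then partition_power (t div 2) $ (m div 2) * refined_count b t (n - t * m) 0 else 0)"
proof (induction m arbitrary: n rule: less_induct)
  case (less m)
  let ?p = "partition_power (t div 2) :: 'a fps" and ?c = "refined_count b t (n - t * m) 0"
  show ?case
  proof (cases "m = 0")
    case False
    have "of_nat m * refined_count b t n m = (\<Sum>k=1..n. refined_ribbons b t k n m)"
      by (rule sum_refined_ribbons[OF t, symmetric])
    also have "\<dots> = (\<Sum>k=1..n. if even m \<and> t * m \<le> n then
        of_nat t * (lambert_part k * ?p) $ (m div 2) * ?c else 0)"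
      by (intro sum.cong refl refined_ribbons_eq[OF t] less.IH) auto
    also have "\<dots> = (if even m \<and> t * m \<le> n then of_nat m * (?p $ (m div 2) * ?c) else 0)"
    proof (cases "even m \<and> t * m \<le> n")
      case True
      have "m \<le> t * m" using t(2) by simp
      then have "m div 2 \<le> n" using True by linarith
      then have "of_nat (m div 2) * ?p $ (m div 2) =
          of_nat (t div 2) * (\<Sum>k=1..n. (lambert_part k * ?p) $ (m div 2))"
        by (rule partition_power_recursion)
      \<comment> \<open>Doubling replaces the halves of \<open>m\<close> and \<open>t\<close> by
        \<open>m\<close> and \<open>t\<close> themselves, both even.\<close>
      then have "of_nat (2 * (m div 2)) * ?p $ (m div 2) =
          of_nat (2 * (t div 2)) * (\<Sum>k=1..n. (lambert_part k * ?p) $ (m div 2))"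
        by simp
      then have "of_nat m * ?p $ (m div 2) = of_nat t * (\<Sum>k=1..n. (lambert_part k * ?p) $ (m div 2))"
        using True t(1) by simp
      then have "of_nat m * ?p $ (m div 2) * ?c = of_nat t * (\<Sum>k=1..n. (lambert_part k * ?p) $ (m div 2)) * ?c"
        by simp
      then show ?thesis using True by (simp add: sum_distrib_left sum_distrib_right mult.assoc)
    next
      case False
      show ?thesis unfolding if_not_P[OF False] by simp
    qed
    finally have "of_nat m * refined_count b t n m =
        of_nat m * (if even m \<and> t * m \<le> n then ?p $ (m div 2) * ?c else 0)" by simp
    then show ?thesis using False by (simp only: mult_cancel_left of_nat_eq_0_iff) simp
  qed simp
qed

text \<open>\<open>F\<close> with a field element \<open>z\<close> in place of \<open>x\<close>, so
  that both the variable itself and 1 can be substituted.\<close>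

definition hook_series :: "'a::field_char_0 \<Rightarrow> nat \<Rightarrow> 'a \<Rightarrow> 'a fps" where
  "hook_series b t z = Abs_fps (\<lambda>n. \<Sum>A\<in>of_weight n. z ^ hook_count t A * b powi sign_sum A)"

text \<open>Summing the closed form over \<open>m = 2 j\<close> splits \<open>F\<close> into a
  series in \<open>y\<close> and the contribution of the partitions without hooks divisible by
  \<open>t\<close>.\<close>

lemma hook_series_eq:
  fixes b z :: "'a::field_char_0"
  assumes t: "even t" "0 < t"
  shows "hook_series b t z =
    (partition_power (t div 2) oo (fps_const (z\<^sup>2) * fps_X ^ (2 * t))) * Abs_fps (\<lambda>n. refined_count b t n 0)"
proof (rule fps_ext)
  fix n
  let ?p = "partition_power (t div 2) :: 'a fps" and ?F = "Abs_fps (\<lambda>n. refined_count b t n 0)"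
    and ?y = "fps_const (z\<^sup>2) * fps_X ^ (2 * t)"
  \<comment> \<open>\<open>M\<close> bounds every hook count at weight \<open>n\<close>; the summand
    \<open>2 n\<close> leaves room for all \<open>m = 2 j\<close> with
    \<open>j \<le> n\<close>.\<close>
  define M where "M = Max (insert 0 (hook_count t ` of_weight n)) + 2 * n"
  have M: "hook_count t A \<le> M" if "A \<in> of_weight n" for A
    using that by (auto simp: M_def intro!: trans_le_add1 Max_ge)
  have "hook_series b t z $ n =
      (\<Sum>A\<in>of_weight n. \<Sum>m\<le>M. z ^ m * (if hook_count t A = m then b powi sign_sum A else 0))"
    unfolding hook_series_def fps_nth_Abs_fps
    by (intro sum.cong refl) (simp add: M if_distrib[of "(*) _"] cong: if_cong)
  also have "\<dots> = (\<Sum>m\<le>M. z ^ m * refined_count b t n m)"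
    unfolding refined_count_def sum_distrib_left by (rule sum.swap)
  also have "\<dots> = (\<Sum>m\<le>M. if even m \<and> t * m \<le> n then z ^ m * (?p $ (m div 2) * ?F $ (n - t * m)) else 0)"
    by (intro sum.cong refl) (subst refined_count_eq[OF t], simp)
  also have "\<dots> = (\<Sum>m\<in>{m\<in>{..M}. even m \<and> t * m \<le> n}. z ^ m * (?p $ (m div 2) * ?F $ (n - t * m)))"
    by (rule sum.inter_filter[symmetric]) simp
  also have "\<dots> = (\<Sum>j\<in>{j\<in>{0..n}. t * (2 * j) \<le> n}. z ^ (2 * j) * (?p $ j * ?F $ (n - t * (2 * j))))"
  proof (rule sum.reindex_bij_witness[of _ "\<lambda>j. 2 * j" "\<lambda>m. m div 2"])
    fix m assume m: "m \<in> {m\<in>{..M}. even m \<and> t * m \<le> n}"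
    have "m \<le> t * m" using t(2) by simp
    also have "\<dots> \<le> n" using m by simp
    finally show "m div 2 \<in> {j\<in>{0..n}. t * (2 * j) \<le> n}" using m by simp
  next
    fix j assume "j \<in> {j\<in>{0..n}. t * (2 * j) \<le> n}"
    then show "2 * j \<in> {m\<in>{..M}. even m \<and> t * m \<le> n}" by (simp add: M_def)
  qed simp_all
  also have "\<dots> = (\<Sum>j=0..n. if t * (2 * j) \<le> n then z ^ (2 * j) * (?p $ j * ?F $ (n - t * (2 * j))) else 0)"
    by (rule sum.inter_filter) simp
  also have "\<dots> = (\<Sum>j=0..n. ?p $ j * (?y ^ j * ?F) $ n)"
  proof (rule sum.cong[OF refl])
    fix j
    have eq: "?y ^ j * ?F = fps_const (z ^ (2 * j)) * (fps_X ^ (t * (2 * j)) * ?F)"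
      by (simp add: power_mult_distrib power_mult[symmetric] mult_ac)
    show "(if t * (2 * j) \<le> n then z ^ (2 * j) * (?p $ j * ?F $ (n - t * (2 * j))) else 0) = ?p $ j * (?y ^ j * ?F) $ n"
      unfolding eq by (simp add: fps_X_power_mult_nth mult.left_commute)
  qed
  also have "\<dots> = ((?p oo ?y) * ?F) $ n"
    using t(2) by (intro fps_compose_mult_nth[symmetric]) simp
  finally show "hook_series b t z $ n = ((?p oo ?y) * ?F) $ n" .
qed

text \<open>Expanding the product of \<open>1 + g a\<close> gives one term per finite set
  \<open>A\<close>. Even \<open>a\<close> supply the exponents \<open>4 j + 1\<close> with
  \<open>b\<close>, odd \<open>a\<close> the exponents \<open>4 j + 3\<close> with the inverse of
  \<open>b\<close>.\<close>

lemma hook_series_1_eq: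
  fixes b :: "'a::field_char_0"
  assumes "b \<noteq> 0"
  shows "hook_series b t 1 =
    qpochhammer_inf (- (fps_const b * fps_X)) (fps_X ^ 4) * qpochhammer_inf (- (fps_X ^ 3 / fps_const b)) (fps_X ^ 4)"
proof (rule fps_ext)
  fix n
  define N where "N = Suc n"
  define g where "g a = fps_const (b powi ((-1) ^ a)) * fps_X ^ (2 * a + 1)" for a :: nat
  let ?u = "- (fps_const b * fps_X)" and ?v = "- (fps_X ^ 3 / fps_const b)" and ?q = "fps_X ^ 4 :: 'a fps"
  have v: "?v = - (fps_const (inverse b) * fps_X ^ 3)"
    using assms by (simp add: fps_divide_unit fps_const_inverse mult.commute)
  have u_nth: "qpochhammer_inf ?u ?q $ i = (\<Prod>j<N. 1 - ?u * ?q ^ j) $ i" if "i \<le> n" for i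
    using that by (intro qpochhammer_inf_nth) (simp_all add: N_def)
  have v_nth: "qpochhammer_inf ?v ?q $ i = (\<Prod>j<N. 1 - ?v * ?q ^ j) $ i" if "i \<le> n" for i
    using that unfolding v by (intro qpochhammer_inf_nth) (simp_all add: N_def)
  have even_g: "1 - ?u * ?q ^ j = 1 + g (2 * j)" for j
    by (simp add: g_def power_mult[symmetric] mult.assoc)
  have odd_g: "1 - ?v * ?q ^ j = 1 + g (Suc (2 * j))" for j
  proof -
    have e: "2 * Suc (2 * j) + 1 = 3 + 4 * j" by simp
    have "g (Suc (2 * j)) = fps_const (inverse b) * (fps_X ^ 3 * ?q ^ j)"
      unfolding g_def e power_add power_mult by (simp add: power_int_minus)
    then show ?thesis unfolding v by (simp only: mult_minus_left mult.assoc diff_minus_eq_add)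
  qed
  have "(qpochhammer_inf ?u ?q * qpochhammer_inf ?v ?q) $ n =
      ((\<Prod>j<N. 1 - ?u * ?q ^ j) * (\<Prod>j<N. 1 - ?v * ?q ^ j)) $ n"
    unfolding fps_mult_nth by (intro sum.cong refl arg_cong2[of _ _ _ _ "(*)"] u_nth v_nth) auto
  also have "(\<Prod>j<N. 1 - ?u * ?q ^ j) * (\<Prod>j<N. 1 - ?v * ?q ^ j) = (\<Prod>a<2 * N. g a + 1)"
    unfolding even_g odd_g by (induction N) (simp_all add: algebra_simps)
  also have "\<dots> = (\<Sum>A\<in>Pow {..<2 * N}. prod g A)"
    by (subst prod_add) simp_all
  also have "\<dots> $ n = (\<Sum>A\<in>Pow {..<2 * N}. if hook_weight A = n then b powi sign_sum A else 0)"
    unfolding fps_sum_nth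
  proof (rule sum.cong[OF refl])
    fix A assume "A \<in> Pow {..<2 * N}"
    then have "finite A" by (auto intro: finite_subset)
    then have "prod g A = fps_const (b powi sign_sum A) * fps_X ^ hook_weight A"
    proof (induction A rule: finite_induct)
      case (insert a A)
      then show ?case
        using assms by (simp add: g_def sign_sum_def hook_weight_def power_int_add power_add mult_ac
            flip: fps_const_mult)
    qed (simp add: sign_sum_def hook_weight_def)
    then show "prod g A $ n = (if hook_weight A = n then b powi sign_sum A else 0)" by simp
  qed
  also have "\<dots> = (\<Sum>A\<in>{A \<in> Pow {..<2 * N}. hook_weight A = n}. b powi sign_sum A)"
    by (rule sum.inter_filter[symmetric]) simp
  also have "{A \<in> Pow {..<2 * N}. hook_weight A = n} = of_weight n"
  proof (intro equalityI subsetI)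
    fix A assume "A \<in> {A \<in> Pow {..<2 * N}. hook_weight A = n}"
    then show "A \<in> of_weight n" by (auto simp: of_weight_def intro: finite_subset)
  next
    fix A assume A: "A \<in> of_weight n"
    then have "A \<subseteq> {..n}" using of_weight_subset by blast
    also have "\<dots> \<subseteq> {..<2 * N}" by (auto simp: N_def)
    finally show "A \<in> {A \<in> Pow {..<2 * N}. hook_weight A = n}" using A by (simp add: of_weight_def)
  qed
  finally show "hook_series b t 1 $ n = (qpochhammer_inf ?u ?q * qpochhammer_inf ?v ?q) $ n"
    by (simp add: hook_series_def)
qed

text \<open>The second factor in \<open>hook_series_eq\<close> does not depend on \<open>z\<close>,
  so it can be eliminated between \<open>z\<close> and 1.\<close>

lemma hook_series_ratio:
  fixes b z :: "'a::field_char_0"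
  assumes t: "even t" "0 < t"
  shows "hook_series b t z = qpochhammer_inf (fps_X ^ (2 * t)) (fps_X ^ (2 * t)) ^ (t div 2)
    / qpochhammer_inf ((fps_const z)\<^sup>2 * fps_X ^ (2 * t)) ((fps_const z)\<^sup>2 * fps_X ^ (2 * t)) ^ (t div 2)
    * hook_series b t 1"
proof -
  let ?Q = "\<lambda>y. qpochhammer_inf y y ^ (t div 2) :: 'a fps"
  let ?y = "(fps_const z)\<^sup>2 * fps_X ^ (2 * t)" and ?q = "fps_X ^ (2 * t) :: 'a fps"
  let ?F = "Abs_fps (\<lambda>n. refined_count b t n 0)"
  have y0: "?y $ 0 = 0" "?q $ 0 = 0" using t(2) by simp_all
  then have Q0: "?Q ?y $ 0 \<noteq> 0" "?Q ?q $ 0 \<noteq> 0" by (simp_all add: fps_power_zeroth qpochhammer_inf_nth_0)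
  have z: "hook_series b t z = inverse (?Q ?y) * ?F"
    using hook_series_eq[OF t, of b z] partition_power_compose[OF y0(1)] by simp
  have "hook_series b t 1 = inverse (?Q ?q) * ?F"
    using hook_series_eq[OF t, of b 1] partition_power_compose[OF y0(2)] by simp
  then have "?Q ?q * hook_series b t 1 = (inverse (?Q ?q) * ?Q ?q) * ?F" by (simp only: ac_simps)
  then have one: "?Q ?q * hook_series b t 1 = ?F"
    by (simp only: inverse_mult_eq_1[OF Q0(2)] mult_1_left)
  have "?Q ?q / ?Q ?y * hook_series b t 1 = inverse (?Q ?y) * (?Q ?q * hook_series b t 1)"
    unfolding fps_divide_unit[OF Q0(1)] by (simp only: ac_simps)
  then show ?thesis by (simp only: one z)
qed

definition ribbon_series :: "'a::field_char_0 \<Rightarrow> nat \<Rightarrow> 'a \<Rightarrow> nat \<Rightarrow> 'a fps" where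
  "ribbon_series b t z k = Abs_fps (\<lambda>n. \<Sum>A\<in>of_weight n.
     z ^ hook_count t A * b powi sign_sum A * of_nat (card (removable (t * k) A)))"

text \<open>With \<open>?w\<close> standing for \<open>y^k\<close>, the relation
  \<open>F_k = y^k (F_k + t k F)\<close> is established coefficientwise and solved for
  \<open>F_k\<close>.\<close>

lemma ribbon_series_eq:
  fixes b z :: "'a::field_char_0"
  assumes t: "even t" "0 < t" and k: "0 < k"
  shows "ribbon_series b t z k = of_nat (t * k) *
    (fps_const z ^ (2 * k) * fps_X ^ (2 * k * t) / (1 - fps_const z ^ (2 * k) * fps_X ^ (2 * k * t))) * hook_series b t z"
proof -
  let ?w = "fps_const z ^ (2 * k) * fps_X ^ (2 * k * t)"
  let ?R = "ribbon_series b t z k" and ?F = "hook_series b t z"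
  have d: "even (t * k)" "0 < t * k" using t k by auto
  have "?R = ?w * (?R + of_nat (t * k) * ?F)"
  proof (rule fps_ext)
    fix n
    have w: "(?w * f) $ n = (if n < 2 * (t * k) then 0 else z ^ (2 * k) * f $ (n - 2 * (t * k)))" for f
      by (simp add: mult.assoc fps_X_power_mult_nth mult.commute[of k t])
    show "?R $ n = (?w * (?R + of_nat (t * k) * ?F)) $ n"
    proof (cases "n < 2 * (t * k)")
      case True
      then show ?thesis
        unfolding w using removable_empty[OF _ d True] by (simp add: ribbon_series_def)
    next
      case False
      define n' where "n' = n - 2 * (t * k)"
      have n: "n = n' + 2 * (t * k)" using False by (simp add: n'_def)
      have "?R $ n = (\<Sum>A\<in>of_weight n'. z ^ (hook_count t A + 2 * k) * b powi sign_sum A * of_nat (card (addable (t * k) A)))"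
        unfolding ribbon_series_def fps_nth_Abs_fps n
        using sum_removable_eq_sum_addable[OF t k, where n = n' and \<phi> = "\<lambda>h g. z ^ h * b powi g"] by simp
      also have "\<dots> = (\<Sum>A\<in>of_weight n'. z ^ (2 * k) *
          (z ^ hook_count t A * b powi sign_sum A * of_nat (card (removable (t * k) A)) +
           of_nat (t * k) * (z ^ hook_count t A * b powi sign_sum A)))"
        using card_addable(1) by (intro sum.cong refl) (auto simp: of_weight_def power_add algebra_simps)
      also have "\<dots> = z ^ (2 * k) * (?R $ n' + of_nat (t * k) * ?F $ n')"
        by (simp only: sum_distrib_left[symmetric] sum.distrib ribbon_series_def hook_series_def fps_nth_Abs_fps)
      finally show ?thesis
        unfolding w using False by (simp add: n'_def flip: fps_of_nat)
    qed
  qed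
  then have "(1 - ?w) * ?R = of_nat (t * k) * ?w * ?F" by (simp add: algebra_simps)
  then have "inverse (1 - ?w) * ((1 - ?w) * ?R) = inverse (1 - ?w) * (of_nat (t * k) * ?w * ?F)"
    by (rule arg_cong)
  then have "(inverse (1 - ?w) * (1 - ?w)) * ?R = of_nat (t * k) * (?w * inverse (1 - ?w)) * ?F"
    by (simp only: ac_simps)
  moreover have w0: "(1 - ?w) $ 0 \<noteq> 0" using t k by simp
  ultimately show ?thesis
    by (simp only: inverse_mult_eq_1[OF w0] mult_1_left fps_divide_unit[OF w0])
qed

section \<open>Complex constants in the coefficient field, and the weighted identity\<close>

definition embed_const :: "complex \<Rightarrow> ratfun" where
  "embed_const c = to_fract [:[:c:]:]"

lemma embed_const_simps: "embed_const (a + c) = embed_const a + embed_const c" "embed_const (a * c) = embed_const a * embed_const c"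
  "embed_const 0 = 0" "embed_const 1 = 1"
  by (simp_all add: embed_const_def to_fract_def eq_fract Zero_fract_def One_fract_def one_pCons)

lemma embed_const_of_nat: "embed_const (of_nat n) = of_nat n"
  by (induction n) (simp_all add: embed_const_simps)

lemma embed_const_sum: "embed_const (sum f I) = (\<Sum>i\<in>I. embed_const (f i))"
  by (induction I rule: infinite_finite_induct) (simp_all add: embed_const_simps)

lemma fps_const_power_int: "fps_const (c :: 'a::field) powi i = fps_const (c powi i)"
  by (simp add: power_int_def fps_const_inverse)

lemma of_nat_powr_add_1:
  assumes "0 < n"
  shows "(of_nat n :: complex) powr (\<beta> + 1) = of_nat n powr \<beta> * of_nat n"
  using assms by (simp add: powr_add)

theorem corollary4p4:
  fixes \<beta> :: complex and t :: nat
  assumes "even t" and "0 < t"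
  shows "(\<Sum>\<^sub>\<infinity>\<mu>\<in>self_conjugate_partitions.
            var_q ^ sum_list \<mu> * var_x ^ size (hooks t \<mu>) * var_b powi BG_rank \<mu>
              * const (\<Sum>h\<in>#hooks t \<mu>. of_nat h powr \<beta>))
         = qpochhammer_inf (var_q ^ (2 * t)) (var_q ^ (2 * t)) ^ (t div 2)
             / qpochhammer_inf (var_x\<^sup>2 * var_q ^ (2 * t)) (var_x\<^sup>2 * var_q ^ (2 * t)) ^ (t div 2)
           * qpochhammer_inf (- (var_b * var_q)) (var_q ^ 4)
           * qpochhammer_inf (- (var_q ^ 3 / var_b)) (var_q ^ 4)
           * (\<Sum>\<^sub>\<infinity>k\<in>{1..}. const (of_nat (t * k) powr (\<beta> + 1))
                * (var_x ^ (2 * k) * var_q ^ (2 * k * t)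
                    / (1 - var_x ^ (2 * k) * var_q ^ (2 * k * t))))"
proof -
  define x :: ratfun where "x = to_fract [:[:0, 1:]:]"
  define b :: ratfun where "b = to_fract [:0, 1:]"
  define c where "c k = embed_const (of_nat (t * k) powr \<beta>)" for k
  define T where "T \<mu> = var_q ^ sum_list \<mu> * var_x ^ size (hooks t \<mu>) * var_b powi BG_rank \<mu>
      * const (\<Sum>h\<in>#hooks t \<mu>. of_nat h powr \<beta>)" for \<mu>
  define f where "f k = const (of_nat (t * k) powr (\<beta> + 1)) * (var_x ^ (2 * k) * var_q ^ (2 * k * t)
      / (1 - var_x ^ (2 * k) * var_q ^ (2 * k * t)))" for k
  let ?F = "hook_series b t x" and ?SC = "\<lambda>n. {\<mu> \<in> self_conjugate_partitions. sum_list \<mu> = n}"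
  note t = assms
  have b0: "b \<noteq> 0" by (simp add: b_def)
  have vars: "var_x = fps_const x" "var_b = fps_const b" "const r = fps_const (embed_const r)" for r
    by (simp_all add: var_x_def var_b_def const_def x_def b_def embed_const_def)

  have T_nth: "T \<mu> $ n = (if sum_list \<mu> = n then x ^ size (hooks t \<mu>) * b powi BG_rank \<mu>
      * embed_const (\<Sum>h\<in>#hooks t \<mu>. of_nat h powr \<beta>) else 0)" for \<mu> n
  proof -
    have "T \<mu> = fps_const (x ^ size (hooks t \<mu>) * b powi BG_rank \<mu>
        * embed_const (\<Sum>h\<in>#hooks t \<mu>. of_nat h powr \<beta>)) * fps_X ^ sum_list \<mu>"
      unfolding T_def vars fps_const_power_int fps_const_power fps_const_mult[symmetric] by (simp only: ac_simps)
    then show ?thesis by simp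
  qed
  \<comment> \<open>The sum over hooks is regrouped by length: each hook of length
    \<open>t k\<close> carries the weight \<open>c k\<close>.\<close>
  have lhs: "infsum T self_conjugate_partitions $ n = (\<Sum>k=1..n. c k * ribbon_series b t x k $ n)" for n
  proof -
    have "infsum T self_conjugate_partitions $ n = (\<Sum>\<mu>\<in>?SC n. T \<mu> $ n)"
      by (rule infsum_fps_nth) (auto simp: finite_self_conjugate_partitions_of T_nth)
    also have "\<dots> = (\<Sum>\<mu>\<in>?SC n. (\<lambda>A. x ^ hook_count t A * b powi sign_sum A *
        (\<Sum>k=1..n. of_nat (card (removable (t * k) A)) * c k)) (diag_arms \<mu>))"
    proof (rule sum.cong[OF refl])
      fix \<mu> assume \<mu>: "\<mu> \<in> ?SC n"
      then have sc: "\<mu> \<in> self_conjugate_partitions" by simp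
      have A: "diag_arms \<mu> \<in> of_weight n" using bij_betw_diag_arms \<mu> by (rule bij_betw_apply)
      have "embed_const (\<Sum>h\<in>#hooks t \<mu>. of_nat h powr \<beta>) =
          (\<Sum>k=1..n. of_nat (card (removable (t * k) (diag_arms \<mu>))) * c k)"
        unfolding sum_hooks_eq[OF sc] sum_inversions[OF A t, where g = "\<lambda>h. of_nat h powr \<beta>"]
        by (simp only: embed_const_sum embed_const_simps embed_const_of_nat c_def)
      then show "T \<mu> $ n = (\<lambda>A. x ^ hook_count t A * b powi sign_sum A *
          (\<Sum>k=1..n. of_nat (card (removable (t * k) A)) * c k)) (diag_arms \<mu>)"
        using \<mu> by (simp add: T_nth size_hooks_eq[OF sc] BG_rank_eq[OF sc])
    qed
    also have "\<dots> = (\<Sum>A\<in>of_weight n. x ^ hook_count t A * b powi sign_sum A *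
        (\<Sum>k=1..n. of_nat (card (removable (t * k) A)) * c k))"
      by (rule sum.reindex_bij_betw[OF bij_betw_diag_arms])
    also have "\<dots> = (\<Sum>k=1..n. c k * ribbon_series b t x k $ n)"
      unfolding ribbon_series_def fps_nth_Abs_fps sum_distrib_left
      by (subst sum.swap) (simp only: ac_simps)
    finally show ?thesis .
  qed

  \<comment> \<open>The factor \<open>t k\<close> from the surplus of addable ribbons raises the
    exponent from \<open>\<beta>\<close> to \<open>\<beta> + 1\<close>.\<close>
  have Ff: "?F * f k = fps_const (c k) * ribbon_series b t x k" if "1 \<le> k" for k
  proof -
    have pos: "0 < t * k" using that t by simp
    have "embed_const (of_nat (t * k) powr (\<beta> + 1)) = c k * of_nat (t * k)"
      unfolding c_def of_nat_powr_add_1[OF pos] embed_const_simps embed_const_of_nat ..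
    then show ?thesis
      using that unfolding f_def vars
      by (simp only: ribbon_series_eq[OF t, of k] fps_const_mult[symmetric] fps_of_nat ac_simps)
  qed
  have f_nth: "f k $ m = 0" if "1 \<le> k" "m < k" for k m
  proof -
    let ?w = "fps_const x ^ (2 * k) * fps_X ^ (2 * k * t)"
    have w0: "(1 - ?w) $ 0 \<noteq> 0" using t that by simp
    have "k \<le> 2 * k * t" using t by (cases t) simp_all
    with that(2) have "m < 2 * k * t" by (rule less_le_trans)
    \<comment> \<open>Divisibility by \<open>q^(2 k t)\<close> makes all terms with
      \<open>k > n\<close> invisible in coefficient \<open>n\<close>.\<close>
    have "f k = fps_X ^ (2 * k * t) *
        (const (of_nat (t * k) powr (\<beta> + 1)) * fps_const x ^ (2 * k) * inverse (1 - ?w))"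
      unfolding f_def vars fps_divide_unit[OF w0] by (simp only: ac_simps)
    then show ?thesis using \<open>m < 2 * k * t\<close> by (simp only: fps_X_power_mult_nth if_True)
  qed
  have rhs: "(?F * infsum f {1..}) $ n = (\<Sum>k=1..n. c k * ribbon_series b t x k $ n)" for n
  proof -
    have f_sum: "infsum f {1..} $ m = (\<Sum>k=1..n. f k) $ m" if "m \<le> n" for m
    proof -
      have "infsum f {1..} $ m = (\<Sum>k=1..m. f k $ m)"
        using f_nth by (intro infsum_fps_nth) auto
      also have "\<dots> = (\<Sum>k=1..n. f k $ m)"
        using that f_nth by (intro sum.mono_neutral_left) auto
      finally show ?thesis by (simp add: fps_sum_nth)
    qed
    then have "(?F * infsum f {1..}) $ n = (?F * (\<Sum>k=1..n. f k)) $ n"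
      by (rule fps_mult_nth_cong)
    also have "\<dots> = (\<Sum>k=1..n. (?F * f k) $ n)"
      by (simp add: sum_distrib_left fps_sum_nth)
    also have "\<dots> = (\<Sum>k=1..n. c k * ribbon_series b t x k $ n)"
      by (intro sum.cong refl) (simp add: Ff)
    finally show ?thesis .
  qed
  have "infsum T self_conjugate_partitions = ?F * infsum f {1..}"
    by (rule fps_ext) (simp only: lhs rhs)
  then show ?thesis
    unfolding T_def f_def hook_series_ratio[OF t, of b x] hook_series_1_eq[OF b0] vars
    by (simp only: mult.assoc)
qed

end
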